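(* Let $L=\bigoplus_{i\ge0}\mathbb{C}[\partial]L_i$ be the Lie conformal algebra, free over $\mathbb{C}[\partial]$ on generators $L_i$ ($i\geq 0$), with $\lambda$-bracket $[L_i\,{}_\lambda\,L_j]=(2\lambda+\partial)L_{i+j}$. For $j\ge0$ let $L_j^*\in L^{*c}$ be defined by $(L_j^* )_\lambda(p(\partial)L_i)=\delta_{ij}\,p(\lambda)$, and let $V=\bigoplus_{i\ge0}\mathbb{C}[\partial]L_i^*\subset L^{*c}$. For $a\in\mathbb{C}\setminus\{0\}$ and $m\in\mathbb{Z}_{\ge0}$ let $f_{a,m}\in L^{*c}$ be defined on generators by $(f_{a,m})_\lambda(L_i)=a^i i^m$ for all $i\ge0$ (with $0^0=1$), and let $$U=\bigoplus_{a\in\mathbb{C}\setminus\{0\},\,m\in\mathbb{Z}_{\ge0}}\mathbb{C}[\partial]f_{a,m}\subset L^{*c}.$$ Then: (a) $U$ is a good $\mathbb{C}[\partial]$-submodule of $L^{*c}$, and its differential Lie coalgebra structure is given on generators by $$\delta(f_{a,m})=\sum_{j=0}^m\binom mj\big(\partial f_{a,j}\otimes f_{a,m-j}-f_{a,j}\otimes\partial f_{a,m-j}\big).$$ (b) $\{f_{a,m}:a\in\mathbb{C}\setminus\{0\},\,m\in\mathbb{Z}_{\ge0}\}\cup\{L_i^*:i\in\mathbb{Z}_{\ge0}\}$ is a $\mathbb{C}[\partial]$-basis of the space of linearly conformal recursive sequences. (c) $L^0=V\oplus U$, and this equals the space of linearly conformal recursive sequences. (d) For each $a\in\mathbb{C}\setminus\{0\}$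 and each $m\in\mathbb{Z}_{\geq 0}$, $\bigoplus_{j=0}^m\mathbb{C}[\partial]f_{a,j}$ is a finite-rank Lie subcoalgebra of $U$. (e) $\operatorname{Loc}(L^0)=V\oplus U=L^0$.
   Context: A Lie conformal algebra $L$ is a $\mathbb{C}[\partial]$-module with a $\mathbb{C}$-linear map $L\otimes L\to\mathbb{C}[\lambda]\otimes L$, $a\otimes b\mapsto[a_\lambda b]$, satisfying $[\partial a_\lambda b]=-\lambda[a_\lambda b]$, $[a_\lambda\partial b]=(\lambda+\partial)[a_\lambda b]$, $[a_\lambda b]=-[b_{-\lambda-\partial}\,a]$, and $[a_\lambda[b_\mu c]]=[[a_\lambda b]_{\lambda+\mu}c]+[b_\mu[a_\lambda c]]$. The conformal dual of a $\mathbb{C}[\partial]$-module $U$ is $U^{*c}=\{f:U\to\mathbb{C}[\lambda]\mid f\ \mathbb{C}\text{-linear},\ f_\lambda(\partial u)=\lambda f_\lambda(u)\}$, with $\mathbb{C}[\partial]$-action $(\partial f)_\lambda=-\lambda f_\lambda$. Tensor products are over $\mathbb{C}$, with $\partial(u\otimes v)=\partial u\otimes v+u\otimes\partial v$. A $\mathbb{C}[\partial]$-module has finite rank if it is of the form $\bigoplus_{i=1}^n\mathbb{C}[\partial]a_i\oplus T$ with the first summand free and $T$ the torsion submodule. A differential Lie coalgebra $(C,\delta)$ is a $\mathbb{C}[\partial]$-module $C$ with a $\mathbb{C}[\partial]$-homomorphism $\delta:C\to C\otimes C$ such that $\tau\delta=-\delta$ and $(I\otimes\delta)\delta-(\tau\otimes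 I)(I\otimes\delta)\delta=(\delta\otimes I)\delta$, where $\tau(a\otimes b)=b\otimes a$. A subcoalgebra is a $\mathbb{C}[\partial]$-submodule $B$ with $\delta(B)\subseteq B\otimes B$. For a differential Lie coalgebra $M$, $\operatorname{Loc}(M)$ is the sum of all finite-rank differential Lie subcoalgebras of $M$. A $\mathbb{C}[\partial]$-submodule $V\subseteq L^{*c}$ is good if for each $f\in V$ there is $\sum f_{(1)}\otimes f_{(2)}\in V\otimes V$ with $f_\lambda([a_\mu b])=\sum(f_{(1)})_{-\mu}(a)\,(f_{(2)})_{\lambda+\mu}(b)$ for all $a,b\in L$; this element is unique and is denoted $\delta_V(f)$, and $(V,\delta_V)$ is a differential Lie coalgebra. $L^0$ is the sum of all good submodules of $L^{*c}$; it is the largest good submodule, and is a differential Lie coalgebra with $\delta_{L^0}$. For the specific $L$ in the claim, an element $f\in L^{*c}$ is called a linearly conformal recursive sequence if there exist $N\in\mathbb{Z}_{\ge0}$ and $\beta_0,\dots,\beta_r\in\mathbb{C}$, not all zero, such that $\sum_{s=0}^r\beta_s\,f_\lambda(L_{m+s})=0$ for all $m\ge N$. *)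

theory Defs
  imports Complex_Main
    "HOL-Computational_Algebra.Polynomial"
    "HOL-Library.Poly_Mapping"
begin

section \<open>Modules over the polynomial ring in \<open>\<partial>\<close>\<close>

class pd_module = ab_group_add +
  fixes pscale :: "complex poly \<Rightarrow> 'a \<Rightarrow> 'a"  (infixr \<open>\<cdot>\<^sub>\<partial>\<close> 75)
  assumes pscale_add_right: "p \<cdot>\<^sub>\<partial> (x + y) = p \<cdot>\<^sub>\<partial> x + p \<cdot>\<^sub>\<partial> y"
    and pscale_add_left: "(p + q) \<cdot>\<^sub>\<partial> x = p \<cdot>\<^sub>\<partial> x + q \<cdot>\<^sub>\<partial> x"
    and pscale_pscale: "p \<cdot>\<^sub>\<partial> (q \<cdot>\<^sub>\<partial> x) = (p * q) \<cdot>\<^sub>\<partial> x"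
    and pscale_one: "1 \<cdot>\<^sub>\<partial> x = x"

global_interpretation pd: module "pscale :: complex poly \<Rightarrow> 'a \<Rightarrow> 'a::pd_module"
  by standard (simp_all add: pscale_add_right pscale_add_left pscale_pscale pscale_one)

definition cscale :: "complex \<Rightarrow> 'a::pd_module \<Rightarrow> 'a"  (infixr \<open>\<cdot>\<^sub>\<complex>\<close> 75)
  where "c \<cdot>\<^sub>\<complex> x = [:c:] \<cdot>\<^sub>\<partial> x"

global_interpretation cvec: vector_space "cscale :: complex \<Rightarrow> 'a \<Rightarrow> 'a::pd_module"
  by standard (simp_all add: cscale_def pd.scale_right_distrib mult.commute flip: pd.scale_left_distrib one_pCons)

definition pd_deriv :: "'a::pd_module \<Rightarrow> 'a"  (\<open>\<partial>\<close>)
  where "\<partial> x = [:0, 1:] \<cdot>\<^sub>\<partial> x"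

text \<open>Bases are indexed families: distinct indices give distinct basis elements.\<close>

definition pd_basis :: "('i \<Rightarrow> 'a::pd_module) \<Rightarrow> 'i set \<Rightarrow> 'a set \<Rightarrow> bool"
  where "pd_basis b I M \<longleftrightarrow> inj_on b I \<and> pd.independent (b ` I) \<and> pd.span (b ` I) = M"

definition is_direct_sum :: "'a::pd_module set \<Rightarrow> 'a set \<Rightarrow> 'a set \<Rightarrow> bool"
  where "is_direct_sum A B M \<longleftrightarrow>
    pd.subspace A \<and> pd.subspace B \<and> A \<inter> B = {0} \<and> M = {a + b |a b. a \<in> A \<and> b \<in> B}"

definition torsion :: "'a::pd_module set \<Rightarrow> 'a set"
  where "torsion M = {x \<in> M. \<exists>p. p \<noteq> 0 \<and> p \<cdot>\<^sub>\<partial> x = 0}"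

definition finite_rank :: "'a::pd_module set \<Rightarrow> bool"
  where "finite_rank M \<longleftrightarrow>
    (\<exists>(n::nat) a F. pd_basis a {..<n} F \<and> is_direct_sum F (torsion M) M)"


section \<open>Lie conformal algebras\<close>

text \<open>
  \<open>\<complex>[\<lambda>] \<otimes> L\<close> is the type of polynomials in \<open>\<lambda>\<close> with coefficients in \<open>L\<close>.
  In two variables, \<open>'l poly poly\<close> is \<open>\<complex>[\<lambda>, \<mu>] \<otimes> L\<close> with \<open>\<lambda>\<close> the inner and \<open>\<mu>\<close> the outer variable.
  For \<open>Q = \<Sum>\<^sub>n x\<^sup>n q\<^sub>n\<close>, \<open>subst_var T \<iota> Q = \<Sum>\<^sub>n T\<^sup>n (\<iota> q\<^sub>n)\<close> replaces the variable \<open>x\<close> by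
  the operator \<open>T\<close> after interpreting the coefficients by \<open>\<iota>\<close>.
\<close>

definition subst_var :: "('m \<Rightarrow> 'm) \<Rightarrow> ('l \<Rightarrow> 'm) \<Rightarrow> 'l::zero poly \<Rightarrow> 'm::comm_monoid_add"
  where "subst_var T \<iota> Q = (\<Sum>n\<le>degree Q. (T ^^ n) (\<iota> (coeff Q n)))"

definition mult_lam :: "'l::ab_group_add poly poly \<Rightarrow> 'l poly poly"
  where "mult_lam Q = map_poly (pCons 0) Q"

definition mult_mu :: "'l::ab_group_add poly poly \<Rightarrow> 'l poly poly"
  where "mult_mu Q = pCons 0 Q"

text \<open>
  \<open>br a b\<close> is \<open>[a\<^sub>\<lambda> b]\<close>.  In the skew-symmetry axiom the operator \<open>-\<lambda> - \<partial>\<close> is substituted for the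
  variable of \<open>[b\<^sub>\<lambda> a]\<close>.
\<close>

locale lie_conformal_algebra =
  fixes br :: "'l::pd_module \<Rightarrow> 'l \<Rightarrow> 'l poly"
  assumes br_add_left: "br (a + a') b = br a b + br a' b"
    and br_add_right: "br a (b + b') = br a b + br a b'"
    and br_cscale_left: "br (z \<cdot>\<^sub>\<complex> a) b = map_poly (cscale z) (br a b)"
    and br_cscale_right: "br a (z \<cdot>\<^sub>\<complex> b) = map_poly (cscale z) (br a b)"
    and br_deriv_left: "br (\<partial> a) b = - pCons 0 (br a b)"
    and br_deriv_right: "br a (\<partial> b) = pCons 0 (br a b) + map_poly \<partial> (br a b)"
    and br_skew: "br a b = - subst_var (\<lambda>q. - pCons 0 q - map_poly \<partial> q) (\<lambda>v. [:v:]) (br b a)"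
    and br_jacobi:
      "subst_var mult_mu (\<lambda>v. subst_var mult_lam (\<lambda>w. [:[:w:]:]) (br a v)) (br b c) =
       subst_var mult_lam (\<lambda>v. subst_var (\<lambda>q. mult_lam q + mult_mu q) (\<lambda>w. [:[:w:]:]) (br v c)) (br a b) +
       subst_var mult_lam (\<lambda>v. subst_var mult_mu (\<lambda>w. [:[:w:]:]) (br b v)) (br a c)"


section \<open>The conformal dual\<close>

definition conformal_functional :: "('u::pd_module \<Rightarrow> complex poly) \<Rightarrow> bool"
  where "conformal_functional f \<longleftrightarrow>
    (\<forall>u v. f (u + v) = f u + f v) \<and> (\<forall>c u. f (c \<cdot>\<^sub>\<complex> u) = smult c (f u)) \<and>
    (\<forall>u. f (\<partial> u) = [:0, 1:] * f u)"

typedef (overloaded) 'u cdual = "{f :: 'u::pd_module \<Rightarrow> complex poly. conformal_functional f}"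
  morphisms dual_apply Abs_cdual
  by (rule exI[of _ "\<lambda>_. 0"]) (simp add: conformal_functional_def)

setup_lifting type_definition_cdual

instantiation cdual :: (pd_module) pd_module
begin

lift_definition zero_cdual :: "'a cdual" is "\<lambda>_. 0"
  by (simp add: conformal_functional_def)

lift_definition plus_cdual :: "'a cdual \<Rightarrow> 'a cdual \<Rightarrow> 'a cdual" is "\<lambda>f g u. f u + g u"
  by (simp add: conformal_functional_def algebra_simps smult_add_right)

lift_definition minus_cdual :: "'a cdual \<Rightarrow> 'a cdual \<Rightarrow> 'a cdual" is "\<lambda>f g u. f u - g u"
  by (simp add: conformal_functional_def algebra_simps smult_diff_right)

lift_definition uminus_cdual :: "'a cdual \<Rightarrow> 'a cdual" is "\<lambda>f u. - f u"
  by (simp add: conformal_functional_def)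

text \<open>\<open>(\<partial> f)\<^sub>\<lambda> = - \<lambda> f\<^sub>\<lambda>\<close>, so \<open>p(\<partial>)\<close> acts as multiplication by \<open>p(-\<lambda>)\<close>.\<close>

lift_definition pscale_cdual :: "complex poly \<Rightarrow> 'a cdual \<Rightarrow> 'a cdual"
  is "\<lambda>p f u. pcompose p [:0, -1:] * f u"
  by (simp add: conformal_functional_def algebra_simps)

instance
proof
  fix a b c :: "'a cdual" and p q :: "complex poly"
  show "a + b + c = a + (b + c)" by transfer (simp add: add.assoc)
  show "a + b = b + a" by transfer (simp add: add.commute)
  show "0 + a = a" by transfer simp
  show "- a + a = 0" by transfer simp
  show "a - b = a + - b" by transfer simp
  show "p \<cdot>\<^sub>\<partial> (a + b) = p \<cdot>\<^sub>\<partial> a + p \<cdot>\<^sub>\<partial> b" by transfer (simp add: distrib_left)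
  show "(p + q) \<cdot>\<^sub>\<partial> a = p \<cdot>\<^sub>\<partial> a + q \<cdot>\<^sub>\<partial> a" by transfer (simp add: pcompose_add distrib_right)
  show "p \<cdot>\<^sub>\<partial> q \<cdot>\<^sub>\<partial> a = (p * q) \<cdot>\<^sub>\<partial> a" by transfer (simp add: pcompose_mult mult.assoc)
  show "1 \<cdot>\<^sub>\<partial> a = a" by transfer (simp add: pcompose_1)
qed

end

lemma dual_apply_deriv: "dual_apply (\<partial> f) u = - [:0, 1:] * dual_apply f u"
  unfolding pd_deriv_def by transfer (simp add: pcompose_pCons)


section \<open>Tensor products over the complex numbers\<close>

text \<open>The free complex vector space on \<open>'a \<times> 'b\<close> modulo the bilinearity relations.\<close>

definition pm_scale :: "complex \<Rightarrow> ('k \<Rightarrow>\<^sub>0 complex) \<Rightarrow> 'k \<Rightarrow>\<^sub>0 complex"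
  where "pm_scale c x = Poly_Mapping.map ((*) c) x"

lemma lookup_pm_scale [simp]: "Poly_Mapping.lookup (pm_scale c x) k = c * Poly_Mapping.lookup x k"
  by (simp add: pm_scale_def map.rep_eq when_def)

global_interpretation pm: vector_space pm_scale
  by standard (auto intro!: poly_mapping_eqI simp: lookup_add algebra_simps)

abbreviation fsingle :: "'a \<Rightarrow> 'b \<Rightarrow> ('a \<times> 'b) \<Rightarrow>\<^sub>0 complex"
  where "fsingle a b \<equiv> Poly_Mapping.single (a, b) 1"

definition bilinear_relators :: "(('a::pd_module \<times> 'b::pd_module) \<Rightarrow>\<^sub>0 complex) set"
  where "bilinear_relators =
    {fsingle (a + a') b - fsingle a b - fsingle a' b |a a' b. True} \<union>
    {fsingle a (b + b') - fsingle a b - fsingle a b' |a b b'. True} \<union>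
    {fsingle (c \<cdot>\<^sub>\<complex> a) b - pm_scale c (fsingle a b) |c a b. True} \<union>
    {fsingle a (c \<cdot>\<^sub>\<complex> b) - pm_scale c (fsingle a b) |c a b. True}"

definition tensor_rel ::
    "(('a::pd_module \<times> 'b::pd_module) \<Rightarrow>\<^sub>0 complex) \<Rightarrow> (('a \<times> 'b) \<Rightarrow>\<^sub>0 complex) \<Rightarrow> bool"
  where "tensor_rel x y \<longleftrightarrow> x - y \<in> pm.span bilinear_relators"

quotient_type (overloaded) ('a, 'b) tensor =
    "('a::pd_module \<times> 'b::pd_module) \<Rightarrow>\<^sub>0 complex" / tensor_rel
proof (rule equivpI)
  show "reflp tensor_rel"
    by (simp add: reflp_def tensor_rel_def pm.span_zero)
  show "symp tensor_rel"
    unfolding symp_def tensor_rel_def using pm.span_neg by fastforce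
  show "transp tensor_rel"
    unfolding transp_def tensor_rel_def using pm.span_add by fastforce
qed

instantiation tensor :: (pd_module, pd_module) ab_group_add
begin

lift_definition zero_tensor :: "('a, 'b) tensor" is 0 .

lift_definition plus_tensor :: "('a, 'b) tensor \<Rightarrow> ('a, 'b) tensor \<Rightarrow> ('a, 'b) tensor" is "(+)"
  unfolding tensor_rel_def by (metis add_diff_add pm.span_add)

lift_definition uminus_tensor :: "('a, 'b) tensor \<Rightarrow> ('a, 'b) tensor" is uminus
  unfolding tensor_rel_def by (metis minus_diff_minus pm.span_neg)

definition minus_tensor :: "('a, 'b) tensor \<Rightarrow> ('a, 'b) tensor \<Rightarrow> ('a, 'b) tensor"
  where "minus_tensor s t = s + - t"

instance
proof
  fix a b c :: "('a, 'b) tensor"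
  show "a + b + c = a + (b + c)"
    by transfer (simp add: tensor_rel_def pm.span_zero algebra_simps)
  show "a + b = b + a"
    by transfer (simp add: tensor_rel_def pm.span_zero algebra_simps)
  show "0 + a = a"
    by transfer (simp add: tensor_rel_def pm.span_zero)
  show "- a + a = 0"
    by transfer (simp add: tensor_rel_def pm.span_zero)
  show "a - b = a + - b"
    by (rule minus_tensor_def)
qed

end

lift_definition pure_tensor :: "'a::pd_module \<Rightarrow> 'b::pd_module \<Rightarrow> ('a, 'b) tensor"
    (infix \<open>\<otimes>\<close> 78)
  is fsingle .

lift_definition tensor_cscale :: "complex \<Rightarrow> ('a::pd_module, 'b::pd_module) tensor \<Rightarrow> ('a, 'b) tensor"
  is pm_scale
  unfolding tensor_rel_def by (metis pm.scale_right_diff_distrib pm.span_scale)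

interpretation tcs: vector_space "tensor_cscale :: complex \<Rightarrow> ('a, 'b) tensor \<Rightarrow> ('a::pd_module, 'b::pd_module) tensor"
  by standard (transfer; simp add: tensor_rel_def pm.span_zero algebra_simps)+

lemma pure_tensor_bilinear:
  "(a + a') \<otimes> b = a \<otimes> b + a' \<otimes> b"
  "a \<otimes> (b + b') = a \<otimes> b + a \<otimes> b'"
  "(c \<cdot>\<^sub>\<complex> a) \<otimes> b = tensor_cscale c (a \<otimes> b)"
  "a \<otimes> (c \<cdot>\<^sub>\<complex> b) = tensor_cscale c (a \<otimes> b)"
  by (transfer; auto simp: tensor_rel_def bilinear_relators_def diff_diff_eq[symmetric]
      intro!: pm.span_base; blast)+

definition free_lift :: "(complex \<Rightarrow> 'c \<Rightarrow> 'c) \<Rightarrow> ('k \<Rightarrow> 'c) \<Rightarrow> ('k \<Rightarrow>\<^sub>0 complex) \<Rightarrow> 'c::ab_group_add"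
  where "free_lift s h x = (\<Sum>k\<in>Poly_Mapping.keys x. s (Poly_Mapping.lookup x k) (h k))"


lemma free_lift_superset:
  assumes "vector_space s" "finite K" "Poly_Mapping.keys x \<subseteq> K"
  shows "free_lift s h x = (\<Sum>k\<in>K. s (Poly_Mapping.lookup x k) (h k))"
proof -
  interpret vector_space s by fact
  show ?thesis
    unfolding free_lift_def using assms(2,3)
    by (intro sum.mono_neutral_left) (auto simp: in_keys_iff)
qed

lemma free_lift_add:
  assumes "vector_space s"
  shows "free_lift s h (x + y) = free_lift s h x + free_lift s h y"
proof -
  interpret vector_space s by fact
  define K where "K = Poly_Mapping.keys x \<union> Poly_Mapping.keys y"
  have "finite K" "Poly_Mapping.keys x \<subseteq> K" "Poly_Mapping.keys y \<subseteq> K"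
      "Poly_Mapping.keys (x + y) \<subseteq> K"
    using keys_add[of x y] by (auto simp: K_def)
  then show ?thesis
    by (simp add: free_lift_superset[OF assms] lookup_add scale_left_distrib sum.distrib)
qed

lemma free_lift_scale:
  assumes "vector_space s"
  shows "free_lift s h (pm_scale c x) = s c (free_lift s h x)"
proof -
  interpret vector_space s by fact
  have "Poly_Mapping.keys (pm_scale c x) \<subseteq> Poly_Mapping.keys x"
    by (auto simp: in_keys_iff)
  then show ?thesis
    by (simp add: free_lift_superset[OF assms, of "Poly_Mapping.keys x"] scale_sum_right)
qed

lemma free_lift_diff:
  assumes "vector_space s"
  shows "free_lift s h (x - y) = free_lift s h x - free_lift s h y"
  using free_lift_add[OF assms, of h "x - y" y] by simp

lemma free_lift_single:
  assumes "vector_space s"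
  shows "free_lift s h (Poly_Mapping.single k 1) = h k"
proof -
  interpret vector_space s by fact
  show ?thesis by (simp add: free_lift_def)
qed

definition bilinear_over ::
    "(complex \<Rightarrow> 'c \<Rightarrow> 'c) \<Rightarrow> ('a::pd_module \<Rightarrow> 'b::pd_module \<Rightarrow> 'c::ab_group_add) \<Rightarrow> bool"
  where "bilinear_over s h \<longleftrightarrow>
    (\<forall>a a' b. h (a + a') b = h a b + h a' b) \<and> (\<forall>a b b'. h a (b + b') = h a b + h a b') \<and>
    (\<forall>c a b. h (c \<cdot>\<^sub>\<complex> a) b = s c (h a b)) \<and> (\<forall>c a b. h a (c \<cdot>\<^sub>\<complex> b) = s c (h a b))"

lemma free_lift_cong:
  assumes s: "vector_space s" and h: "bilinear_over s h" and "tensor_rel x y"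
  shows "free_lift s (case_prod h) x = free_lift s (case_prod h) y"
proof -
  interpret vector_space s by fact
  have "free_lift s (case_prod h) z = 0" if "z \<in> pm.span bilinear_relators" for z
    using that
  proof (induction rule: pm.span_induct)
    show "pm.subspace {z. free_lift s (case_prod h) z = 0}"
      by (rule pm.subspaceI)
        (simp_all add: free_lift_add[OF s] free_lift_scale[OF s] free_lift_def[of _ _ 0])
  qed (use h in \<open>auto simp: bilinear_relators_def bilinear_over_def
      free_lift_diff[OF s] free_lift_scale[OF s] free_lift_single[OF s]\<close>)
  from this[of "x - y"] show ?thesis
    using assms(3) by (simp add: tensor_rel_def free_lift_diff[OF s])
qed

lemma free_lift_rep_tensor:
  assumes "vector_space s" "bilinear_over s h"
  shows "free_lift s (case_prod h) (rep_tensor (abs_tensor x)) = free_lift s (case_prod h) x"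
  by (rule free_lift_cong[OF assms]) (metis Quotient3_rep_abs Quotient3_tensor tensor.abs_eq_iff)

text \<open>\<open>\<partial> (u \<otimes> v) = \<partial> u \<otimes> v + u \<otimes> \<partial> v\<close>\<close>

definition tensor_deriv :: "('a::pd_module, 'b::pd_module) tensor \<Rightarrow> ('a, 'b) tensor"
  where "tensor_deriv t =
    free_lift tensor_cscale (\<lambda>(u, v). \<partial> u \<otimes> v + u \<otimes> \<partial> v) (rep_tensor t)"

lemma pd_deriv_add: "\<partial> (x + y) = \<partial> x + \<partial> y"
  by (simp add: pd_deriv_def pd.scale_right_distrib)

lemma pd_deriv_cscale: "\<partial> (c \<cdot>\<^sub>\<complex> x) = c \<cdot>\<^sub>\<complex> \<partial> x"
  by (simp add: pd_deriv_def cscale_def)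

lemma bilinear_over_deriv:
  "bilinear_over tensor_cscale (\<lambda>(u::'a::pd_module) (v::'b::pd_module). \<partial> u \<otimes> v + u \<otimes> \<partial> v)"
  by (auto simp: bilinear_over_def pd_deriv_add pd_deriv_cscale pure_tensor_bilinear
      tcs.scale_right_distrib)

lemma tensor_deriv_add: "tensor_deriv (s + t) = tensor_deriv s + tensor_deriv t"
  unfolding tensor_deriv_def
  by (induction s, induction t)
    (simp add: free_lift_rep_tensor[OF tcs.vector_space_axioms bilinear_over_deriv]
      free_lift_add[OF tcs.vector_space_axioms] plus_tensor.abs_eq)

lemma tensor_deriv_cscale: "tensor_deriv (tensor_cscale c t) = tensor_cscale c (tensor_deriv t)"
  unfolding tensor_deriv_def
  by (induction t)
    (simp add: free_lift_rep_tensor[OF tcs.vector_space_axioms bilinear_over_deriv]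
      free_lift_scale[OF tcs.vector_space_axioms] tensor_cscale.abs_eq)

lemma tensor_deriv_pure: "tensor_deriv (u \<otimes> v) = \<partial> u \<otimes> v + u \<otimes> \<partial> v"
  unfolding tensor_deriv_def pure_tensor.abs_eq[of u v]
  by (simp add: free_lift_rep_tensor[OF tcs.vector_space_axioms bilinear_over_deriv]
      free_lift_single[OF tcs.vector_space_axioms])

instantiation tensor :: (pd_module, pd_module) pd_module
begin

definition pscale_tensor :: "complex poly \<Rightarrow> ('a, 'b) tensor \<Rightarrow> ('a, 'b) tensor"
  where "pscale_tensor p t = (\<Sum>n\<le>degree p. tensor_cscale (coeff p n) ((tensor_deriv ^^ n) t))"

lemma pscale_tensor_bound:
  assumes "degree p \<le> N"
  shows "p \<cdot>\<^sub>\<partial> (t :: ('a, 'b) tensor) = (\<Sum>n\<le>N. tensor_cscale (coeff p n) ((tensor_deriv ^^ n) t))"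
  unfolding pscale_tensor_def using assms
  by (intro sum.mono_neutral_left) (auto simp: coeff_eq_0)

lemma tensor_deriv_funpow_add: "(tensor_deriv ^^ n) (s + t) = (tensor_deriv ^^ n) s + (tensor_deriv ^^ n) t"
  by (induction n) (simp_all add: tensor_deriv_add)

lemma tensor_deriv_sum: "tensor_deriv (sum f A) = (\<Sum>x\<in>A. tensor_deriv (f x))"
proof (induction A rule: infinite_finite_induct)
  case empty
  show ?case using tensor_deriv_cscale[of 0 0] by simp
next
  case (infinite A)
  then show ?case using tensor_deriv_cscale[of 0 0] by simp
qed (simp add: tensor_deriv_add)

lemma pscale_tensor_pCons:
  "pCons c p \<cdot>\<^sub>\<partial> (t :: ('a, 'b) tensor) = tensor_cscale c t + tensor_deriv (p \<cdot>\<^sub>\<partial> t)"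
proof -
  have "pCons c p \<cdot>\<^sub>\<partial> t = (\<Sum>n\<le>Suc (degree p). tensor_cscale (coeff (pCons c p) n) ((tensor_deriv ^^ n) t))"
    by (rule pscale_tensor_bound) (simp add: degree_pCons_le)
  also have "\<dots> = tensor_cscale c t + (\<Sum>n\<le>degree p. tensor_cscale (coeff p n) ((tensor_deriv ^^ Suc n) t))"
    by (subst sum.atMost_Suc_shift) simp
  also have "(\<Sum>n\<le>degree p. tensor_cscale (coeff p n) ((tensor_deriv ^^ Suc n) t)) = tensor_deriv (p \<cdot>\<^sub>\<partial> t)"
    by (simp add: pscale_tensor_def tensor_deriv_sum tensor_deriv_cscale)
  finally show ?thesis .
qed

instance
proof
  fix p q :: "complex poly" and x y :: "('a, 'b) tensor"
  show "p \<cdot>\<^sub>\<partial> (x + y) = p \<cdot>\<^sub>\<partial> x + p \<cdot>\<^sub>\<partial> y"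
    by (simp add: pscale_tensor_def tensor_deriv_funpow_add tcs.scale_right_distrib sum.distrib)
  show add_left: "(p + q) \<cdot>\<^sub>\<partial> x = p \<cdot>\<^sub>\<partial> x + q \<cdot>\<^sub>\<partial> x" for p q and x :: "('a, 'b) tensor"
    by (simp add: pscale_tensor_bound[of _ "max (degree p) (degree q)"] degree_add_le
        tcs.scale_left_distrib sum.distrib)
  have smult: "smult c p \<cdot>\<^sub>\<partial> x = tensor_cscale c (p \<cdot>\<^sub>\<partial> x)" for c p and x :: "('a, 'b) tensor"
    by (simp add: pscale_tensor_bound[of "smult c p" "degree p"] pscale_tensor_def tcs.scale_sum_right)
  have zero: "0 \<cdot>\<^sub>\<partial> x = (0 :: ('a, 'b) tensor)" for x
    by (simp add: pscale_tensor_def)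
  show "p \<cdot>\<^sub>\<partial> (q \<cdot>\<^sub>\<partial> x) = (p * q) \<cdot>\<^sub>\<partial> x"
  proof (induction p)
    case (pCons c p)
    show ?case
      by (simp add: pscale_tensor_pCons[of c p] pscale_tensor_pCons[of 0 "p * q"]
          add_left smult pCons.IH)
  qed (simp add: zero)
  show "1 \<cdot>\<^sub>\<partial> x = x"
    by (simp add: pscale_tensor_def)
qed

end

lemma deriv_tensor: "\<partial> t = tensor_deriv (t :: ('a::pd_module, 'b::pd_module) tensor)"
  using tensor_deriv_cscale[of 0 t]
  by (simp add: pd_deriv_def pscale_tensor_pCons)

lemma cscale_tensor: "c \<cdot>\<^sub>\<complex> t = tensor_cscale c (t :: ('a::pd_module, 'b::pd_module) tensor)"
  using tensor_deriv_cscale[of 0 t]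
  by (simp add: cscale_def pscale_tensor_pCons)

text \<open>
  Over a field \<open>A \<otimes> B\<close> embeds in the tensor product of the ambient modules.
\<close>

definition tensor_sub :: "'a::pd_module set \<Rightarrow> 'b::pd_module set \<Rightarrow> ('a, 'b) tensor set"
  where "tensor_sub A B = cvec.span {a \<otimes> b |a b. a \<in> A \<and> b \<in> B}"

text \<open>
  The linear map \<open>A \<otimes> B \<rightarrow> 'c\<close> induced by a map \<open>h\<close> that is bilinear on \<open>A \<times> B\<close> (and arbitrary
  outside): evaluate \<open>h\<close> on a representative supported in \<open>A \<times> B\<close>.
\<close>

definition tensor_lift_on ::
    "'a::pd_module set \<Rightarrow> 'b::pd_module set \<Rightarrow> ('a \<Rightarrow> 'b \<Rightarrow> 'c::pd_module) \<Rightarrow> ('a, 'b) tensor \<Rightarrow> 'c"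
  where "tensor_lift_on A B h t =
    free_lift cscale (case_prod h) (SOME x. Poly_Mapping.keys x \<subseteq> A \<times> B \<and> abs_tensor x = t)"

abbreviation tensor_lift ::
    "('a::pd_module \<Rightarrow> 'b::pd_module \<Rightarrow> 'c::pd_module) \<Rightarrow> ('a, 'b) tensor \<Rightarrow> 'c"
  where "tensor_lift \<equiv> tensor_lift_on UNIV UNIV"

lemma tensor_lift_pure:
  assumes "bilinear_over cscale h"
  shows "tensor_lift h (a \<otimes> b) = h a b"
proof -
  let ?P = "\<lambda>x. Poly_Mapping.keys x \<subseteq> UNIV \<times> UNIV \<and> abs_tensor x = a \<otimes> b"
  have "?P (fsingle a b)"
    by (simp add: pure_tensor.abs_eq)
  then have "?P (Eps ?P)"
    by (rule someI)
  then have "tensor_rel (Eps ?P) (fsingle a b)"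
    by (simp add: pure_tensor.abs_eq tensor.abs_eq_iff)
  then show ?thesis
    unfolding tensor_lift_on_def
    by (simp add: free_lift_cong[OF cvec.vector_space_axioms assms]
        free_lift_single[OF cvec.vector_space_axioms])
qed

definition tensor_map_on ::
    "'a::pd_module set \<Rightarrow> 'b::pd_module set \<Rightarrow> ('a \<Rightarrow> 'c::pd_module) \<Rightarrow> ('b \<Rightarrow> 'd::pd_module) \<Rightarrow>
      ('a, 'b) tensor \<Rightarrow> ('c, 'd) tensor"
  where "tensor_map_on A B f g = tensor_lift_on A B (\<lambda>a b. f a \<otimes> g b)"

definition tensor_swap :: "('a::pd_module, 'b::pd_module) tensor \<Rightarrow> ('b, 'a) tensor"
  where "tensor_swap = tensor_lift (\<lambda>a b. b \<otimes> a)"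

text \<open>The canonical isomorphism \<open>A \<otimes> (B \<otimes> C) \<rightarrow> (A \<otimes> B) \<otimes> C\<close>.\<close>

definition tensor_assoc ::
    "('a::pd_module, ('b::pd_module, 'c::pd_module) tensor) tensor \<Rightarrow> (('a, 'b) tensor, 'c) tensor"
  where "tensor_assoc = tensor_lift (\<lambda>a. tensor_lift (\<lambda>b c. (a \<otimes> b) \<otimes> c))"


section \<open>Differential Lie coalgebras\<close>

text \<open>A coalgebra is given by a submodule \<open>C\<close> and a map \<open>\<delta>\<close>, of which only the values on \<open>C\<close> matter.\<close>

definition diff_lie_coalgebra ::
    "'a::pd_module set \<Rightarrow> ('a \<Rightarrow> ('a, 'a) tensor) \<Rightarrow> bool"
  where "diff_lie_coalgebra C \<delta> \<longleftrightarrow>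
    pd.subspace C \<and> \<delta> ` C \<subseteq> tensor_sub C C \<and>
    (\<forall>x\<in>C. \<forall>y\<in>C. \<delta> (x + y) = \<delta> x + \<delta> y) \<and>
    (\<forall>p. \<forall>x\<in>C. \<delta> (p \<cdot>\<^sub>\<partial> x) = p \<cdot>\<^sub>\<partial> \<delta> x) \<and>
    (\<forall>x\<in>C. tensor_swap (\<delta> x) = - \<delta> x) \<and>
    (\<forall>x\<in>C. let t = tensor_assoc (tensor_map_on C C id \<delta> (\<delta> x)) in
      t - tensor_map_on UNIV UNIV tensor_swap id t = tensor_map_on C C \<delta> id (\<delta> x))"

definition diff_lie_subcoalgebra ::
    "'a::pd_module set \<Rightarrow> ('a \<Rightarrow> ('a, 'a) tensor) \<Rightarrow> 'a set \<Rightarrow> bool"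
  where "diff_lie_subcoalgebra C \<delta> B \<longleftrightarrow>
    pd.subspace B \<and> B \<subseteq> C \<and> \<delta> ` B \<subseteq> tensor_sub B B"

definition Loc :: "'a::pd_module set \<Rightarrow> ('a \<Rightarrow> ('a, 'a) tensor) \<Rightarrow> 'a set"
  where "Loc C \<delta> = pd.span (\<Union>{B. diff_lie_subcoalgebra C \<delta> B \<and> finite_rank B})"


section \<open>Good submodules of the conformal dual\<close>

text \<open>
  \<open>\<complex>[\<lambda>, \<mu>]\<close> is \<open>complex poly poly\<close>, again with \<open>\<lambda>\<close> the inner and \<open>\<mu>\<close> the outer variable;
  \<open>poly_at p x\<close> is \<open>p(x)\<close> for a complex polynomial \<open>p\<close> and \<open>x \<in> \<complex>[\<lambda>, \<mu>]\<close>.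
\<close>

abbreviation (input) var_lam :: "complex poly poly"
  where "var_lam \<equiv> [:[:0, 1:]:]"

abbreviation (input) var_mu :: "complex poly poly"
  where "var_mu \<equiv> [:0, 1:]"

definition poly_at :: "complex poly \<Rightarrow> complex poly poly \<Rightarrow> complex poly poly"
  where "poly_at p x = poly (map_poly (\<lambda>c. [:[:c:]:]) p) x"

text \<open>
  \<open>t = \<Sum> f\<^sub>(\<^sub>1\<^sub>) \<otimes> f\<^sub>(\<^sub>2\<^sub>)\<close> with factors in \<open>V\<close> and
  \<open>f\<^sub>\<lambda>([a\<^sub>\<mu> b]) = \<Sum> (f\<^sub>(\<^sub>1\<^sub>))\<^sub>-\<^sub>\<mu>(a) (f\<^sub>(\<^sub>2\<^sub>))\<^sub>\<lambda>\<^sub>+\<^sub>\<mu>(b)\<close> for all \<open>a\<close>, \<open>b\<close>.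
  On the left, \<open>f\<close> acts on the coefficients of \<open>[a\<^sub>\<mu> b]\<close>.
\<close>

definition is_coproduct ::
    "('l::pd_module \<Rightarrow> 'l \<Rightarrow> 'l poly) \<Rightarrow> 'l cdual set \<Rightarrow> 'l cdual \<Rightarrow> ('l cdual, 'l cdual) tensor \<Rightarrow> bool"
  where "is_coproduct br V f t \<longleftrightarrow>
    (\<exists>(n::nat) g h. (\<forall>k<n. g k \<in> V \<and> h k \<in> V) \<and> t = (\<Sum>k<n. g k \<otimes> h k) \<and>
      (\<forall>a b. map_poly (dual_apply f) (br a b) =
        (\<Sum>k<n. poly_at (dual_apply (g k) a) (- var_mu) *
                 poly_at (dual_apply (h k) b) (var_lam + var_mu))))"

definition good_submodule :: "('l::pd_module \<Rightarrow> 'l \<Rightarrow> 'l poly) \<Rightarrow> 'l cdual set \<Rightarrow> bool"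
  where "good_submodule br V \<longleftrightarrow> pd.subspace V \<and> (\<forall>f\<in>V. \<exists>t. is_coproduct br V f t)"

definition good_coproduct ::
    "('l::pd_module \<Rightarrow> 'l \<Rightarrow> 'l poly) \<Rightarrow> 'l cdual set \<Rightarrow> 'l cdual \<Rightarrow> ('l cdual, 'l cdual) tensor"
  where "good_coproduct br V f = (THE t. is_coproduct br V f t)"

definition largest_good :: "('l::pd_module \<Rightarrow> 'l \<Rightarrow> 'l poly) \<Rightarrow> 'l cdual set"
  where "largest_good br = pd.span (\<Union>{V. good_submodule br V})"


section \<open>Functionals on an algebra with basis \<open>Lg\<close>\<close>

text \<open>Both functionals exist uniquely when \<open>Lg\<close> is a basis.\<close>

definition dual_gen :: "(nat \<Rightarrow> 'l::pd_module) \<Rightarrow> nat \<Rightarrow> 'l cdual"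
  where "dual_gen Lg j =
    (THE f. \<forall>p i. dual_apply f (p \<cdot>\<^sub>\<partial> Lg i) = (if i = j then p else 0))"

definition exp_poly_dual :: "(nat \<Rightarrow> 'l::pd_module) \<Rightarrow> complex \<Rightarrow> nat \<Rightarrow> 'l cdual"
  where "exp_poly_dual Lg a m =
    (THE f. \<forall>i. dual_apply f (Lg i) = [:a ^ i * of_nat i ^ m:])"

definition linearly_recursive :: "(nat \<Rightarrow> 'l::pd_module) \<Rightarrow> 'l cdual \<Rightarrow> bool"
  where "linearly_recursive Lg f \<longleftrightarrow>
    (\<exists>N r \<beta>. (\<exists>s\<le>r. \<beta> s \<noteq> (0::complex)) \<and>
      (\<forall>m\<ge>N. (\<Sum>s\<le>r. smult (\<beta> s) (dual_apply f (Lg (m + s)))) = 0))"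

end

theory Submission
  imports Defs "HOL-Computational_Algebra.Fundamental_Theorem_Algebra"
begin

text \<open>
  A conformal functional on \<open>L\<close> is an arbitrary sequence \<open>i \<mapsto> f\<^sub>\<lambda>(L\<^sub>i)\<close> of polynomials.  With \<open>x = -\<mu>\<close>
  and \<open>y = \<lambda> + \<mu>\<close> the coproduct condition on generators reads
  \<open>(y - x) f\<^sub>x\<^sub>+\<^sub>y(L\<^sub>i\<^sub>+\<^sub>j) = \<Sum> (f\<^sub>(\<^sub>1\<^sub>))\<^sub>x(L\<^sub>i) (f\<^sub>(\<^sub>2\<^sub>))\<^sub>y(L\<^sub>j)\<close>.  Since products of separating families of
  functionals separate the points of a tensor product, every identity between (iterated) coproducts
  reduces to an identity between these values; co-Jacobi becomes
  \<open>(z - y)(y + z - x) - (z - x)(x + z - y) = (y - x)(z - x - y)\<close>.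
  Setting \<open>x = 0\<close> and using that the first factors then span a finite-dimensional space shows that
  the elements of a good submodule are linearly recursive.  Conversely, a recursive sequence is
  killed by some \<open>q(E)\<close>, \<open>E\<close> the shift; splitting off linear factors \<open>E - a\<close> of \<open>q\<close>, which are
  surjective on \<open>V + U\<close> and have their kernel in \<open>V + U\<close>, shows that it lies in \<open>V + U\<close>.
\<close>

section \<open>Separating functionals on tensor products\<close>

definition functional :: "('a::pd_module \<Rightarrow> complex) \<Rightarrow> bool"
  where "functional \<phi> \<longleftrightarrow>
    (\<forall>u v. \<phi> (u + v) = \<phi> u + \<phi> v) \<and> (\<forall>c u. \<phi> (c \<cdot>\<^sub>\<complex> u) = c * \<phi> u)"

lemma functionalI:
  assumes "\<And>u v. \<phi> (u + v) = \<phi> u + \<phi> v" "\<And>c u. \<phi> (c \<cdot>\<^sub>\<complex> u) = c * \<phi> u"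
  shows "functional \<phi>"
  using assms by (simp add: functional_def)

lemma functional_add: "functional \<phi> \<Longrightarrow> \<phi> (u + v) = \<phi> u + \<phi> v"
  and functional_cscale: "functional \<phi> \<Longrightarrow> \<phi> (c \<cdot>\<^sub>\<complex> u) = c * \<phi> u"
  by (simp_all add: functional_def)

lemma functional_zero: "functional \<phi> \<Longrightarrow> \<phi> 0 = 0"
  using functional_cscale[of \<phi> 0 0] by simp

lemma functional_neg: "functional \<phi> \<Longrightarrow> \<phi> (- u) = - \<phi> u"
  by (metis add_eq_0_iff functional_add functional_zero add.right_inverse)

lemma functional_diff: "functional \<phi> \<Longrightarrow> \<phi> (u - v) = \<phi> u - \<phi> v"
  by (metis diff_conv_add_uminus functional_add functional_neg)

lemma functional_sum: "functional \<phi> \<Longrightarrow> \<phi> (sum g A) = (\<Sum>k\<in>A. \<phi> (g k))"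
  by (induction A rule: infinite_finite_induct) (simp_all add: functional_zero functional_add)

lemma functional_mult: "functional \<phi> \<Longrightarrow> functional (\<lambda>u. c * \<phi> u)"
  by (simp add: functional_def algebra_simps)

section \<open>Complex-valued bilinear forms on tensor products\<close>

lemma vector_space_complex: "vector_space ((*) :: complex \<Rightarrow> complex \<Rightarrow> complex)"
  by standard (auto simp: algebra_simps)

text \<open>The target of \<open>tensor_lift\<close> is a module over the polynomial ring in
  \<partial>. The complex numbers carry no such structure here, so scalar-valued forms are extended
  through \<open>free_lift\<close> directly.\<close>

definition bilinear_eval ::
    "('a::pd_module \<Rightarrow> 'b::pd_module \<Rightarrow> complex) \<Rightarrow> ('a, 'b) tensor \<Rightarrow> complex"
  where "bilinear_eval H t = free_lift (*) (case_prod H) (rep_tensor t)"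

lemma bilinear_eval_abs:
  assumes "bilinear_over (*) H"
  shows "bilinear_eval H (abs_tensor x) = free_lift (*) (case_prod H) x"
  unfolding bilinear_eval_def by (rule free_lift_rep_tensor[OF vector_space_complex assms])

lemma bilinear_eval_pure:
  assumes "bilinear_over (*) H"
  shows "bilinear_eval H (a \<otimes> b) = H a b"
  by (simp add: pure_tensor.abs_eq bilinear_eval_abs[OF assms]
      free_lift_single[OF vector_space_complex])

lemma functional_bilinear_eval:
  assumes "bilinear_over (*) H"
  shows "functional (bilinear_eval H)"
proof (rule functionalI)
  show "bilinear_eval H (u + v) = bilinear_eval H u + bilinear_eval H v" for u v
    by (induction u, induction v)
      (simp add: plus_tensor.abs_eq bilinear_eval_abs[OF assms] free_lift_add[OF vector_space_complex])
  show "bilinear_eval H (c \<cdot>\<^sub>\<complex> u) = c * bilinear_eval H u" for c u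
    by (induction u)
      (simp add: cscale_tensor tensor_cscale.abs_eq bilinear_eval_abs[OF assms]
        free_lift_scale[OF vector_space_complex])
qed

lemma tensor_sub_pure: "a \<in> A \<Longrightarrow> b \<in> B \<Longrightarrow> a \<otimes> b \<in> tensor_sub A B"
  unfolding tensor_sub_def by (auto intro: cvec.span_base)

lemma tensor_sub_mono: "A \<subseteq> A' \<Longrightarrow> B \<subseteq> B' \<Longrightarrow> tensor_sub A B \<subseteq> tensor_sub A' B'"
  unfolding tensor_sub_def by (rule cvec.span_mono) auto

lemma subspace_tensor_sub: "cvec.subspace (tensor_sub A B)"
  unfolding tensor_sub_def by simp

text \<open>This makes the choice in \<open>tensor_lift_on\<close> meaningful: for \<open>t\<close>
  in \<open>tensor_sub A B\<close> the \<open>SOME\<close> ranges over a nonempty set of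
  representatives.\<close>

lemma tensor_sub_imp_rep:
  assumes "t \<in> tensor_sub A B"
  shows "\<exists>x. Poly_Mapping.keys x \<subseteq> A \<times> B \<and> abs_tensor x = t"
  using assms unfolding tensor_sub_def
proof (induction rule: cvec.span_induct)
  case base
  let ?S = "{t. \<exists>x. Poly_Mapping.keys x \<subseteq> A \<times> B \<and> abs_tensor x = t}"
  show "cvec.subspace ?S"
  proof (rule cvec.subspaceI)
    show "0 \<in> ?S"
      by (auto simp: zero_tensor.abs_eq intro!: exI[of _ 0])
  next
    fix s t assume "s \<in> ?S" "t \<in> ?S"
    then obtain x y where "Poly_Mapping.keys x \<subseteq> A \<times> B" "abs_tensor x = s"
      "Poly_Mapping.keys y \<subseteq> A \<times> B" "abs_tensor y = t" by blast
    then show "s + t \<in> ?S"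
      using keys_add[of x y] by (auto simp flip: plus_tensor.abs_eq intro!: exI[of _ "x + y"])
  next
    fix c t assume "t \<in> ?S"
    then obtain x where x: "Poly_Mapping.keys x \<subseteq> A \<times> B" "abs_tensor x = t" by blast
    moreover have "Poly_Mapping.keys (pm_scale c x) \<subseteq> Poly_Mapping.keys x"
      by (auto simp: in_keys_iff)
    ultimately show "c \<cdot>\<^sub>\<complex> t \<in> ?S"
      by (auto simp: cscale_tensor simp flip: tensor_cscale.abs_eq intro!: exI[of _ "pm_scale c x"])
  qed
next
  case (step t)
  then obtain a b where "t = a \<otimes> b" "a \<in> A" "b \<in> B" by blast
  then show ?case
    by (intro exI[of _ "fsingle a b"]) (simp add: pure_tensor.abs_eq)
qed

lemma rep_in_tensor_sub:
  assumes "Poly_Mapping.keys x \<subseteq> A \<times> B"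
  shows "abs_tensor x \<in> tensor_sub A B"
proof -
  \<comment> \<open>The induction runs over a finite set \<open>K\<close> bounding the support:
    removing the \<open>k\<close>-component leaves a representative supported in the smaller set and
    splits off a multiple of a pure tensor.\<close>
  have "abs_tensor x \<in> tensor_sub A B" if "finite K" "Poly_Mapping.keys x \<subseteq> K" "K \<subseteq> A \<times> B" for K x
    using that
  proof (induction K arbitrary: x rule: finite_induct)
    case empty
    then have "abs_tensor x = 0" by (simp add: zero_tensor.abs_eq)
    then show ?case by (simp add: tensor_sub_def cvec.span_zero)
  next
    case (insert k K)
    obtain a b where k: "k = (a, b)" by force
    define c where "c = Poly_Mapping.lookup x k"
    define y where "y = x - pm_scale c (Poly_Mapping.single k 1)"
    have "Poly_Mapping.keys y \<subseteq> K"
      using insert.prems(1) by (auto simp: y_def c_def in_keys_iff lookup_minus lookup_single when_def split: if_splits)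
    then have y: "abs_tensor y \<in> tensor_sub A B"
      using insert by auto
    have "x = y + pm_scale c (Poly_Mapping.single k 1)"
      by (simp add: y_def)
    then have "abs_tensor x = abs_tensor y + c \<cdot>\<^sub>\<complex> (a \<otimes> b)"
      by (simp add: k cscale_tensor pure_tensor.abs_eq tensor_cscale.abs_eq plus_tensor.abs_eq)
    with y insert.prems(2) k show ?case
      by (auto intro!: cvec.subspace_add[OF subspace_tensor_sub]
          cvec.subspace_scale[OF subspace_tensor_sub] tensor_sub_pure)
  qed
  with assms show ?thesis
    by (metis finite_keys subset_refl)
qed

lemma tensor_sub_UNIV: "tensor_sub UNIV UNIV = UNIV"
proof -
  have "t \<in> tensor_sub UNIV UNIV" for t :: "('a, 'b) tensor"
    by (induction t) (simp add: rep_in_tensor_sub)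
  then show ?thesis by blast
qed

lemma functional_free_lift:
  assumes "functional \<phi>"
  shows "\<phi> (free_lift cscale h x) = free_lift (*) (\<lambda>k. \<phi> (h k)) x"
  by (simp add: free_lift_def functional_sum[OF assms] functional_cscale[OF assms])

text \<open>
  No well-definedness of \<open>tensor_lift_on\<close> is needed: after applying a functional, the chosen
  representative only enters through a form that is bilinear everywhere.
\<close>

lemma functional_tensor_lift_on:
  assumes "functional \<phi>" "bilinear_over (*) H" "t \<in> tensor_sub A B"
    and "\<And>a b. a \<in> A \<Longrightarrow> b \<in> B \<Longrightarrow> \<phi> (h a b) = H a b"
  shows "\<phi> (tensor_lift_on A B h t) = bilinear_eval H t"
proof -
  define x where "x = (SOME x. Poly_Mapping.keys x \<subseteq> A \<times> B \<and> abs_tensor x = t)"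
  have x: "Poly_Mapping.keys x \<subseteq> A \<times> B" "abs_tensor x = t"
    using someI_ex[OF tensor_sub_imp_rep[OF assms(3)]] by (auto simp: x_def)
  have "\<phi> (tensor_lift_on A B h t) = free_lift (*) (\<lambda>k. \<phi> (case_prod h k)) x"
    unfolding tensor_lift_on_def x_def[symmetric] by (rule functional_free_lift[OF assms(1)])
  also have "\<dots> = free_lift (*) (case_prod H) x"
    unfolding free_lift_def using x(1) assms(4) by (intro sum.cong) auto
  also have "\<dots> = bilinear_eval H t"
    using bilinear_eval_abs[OF assms(2), of x] by (simp add: x(2))
  finally show ?thesis .
qed

lemma functional_tensor_lift:
  assumes "functional \<phi>" "bilinear_over (*) H" and "\<And>a b. \<phi> (h a b) = H a b"
  shows "\<phi> (tensor_lift h t) = bilinear_eval H t"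
  using functional_tensor_lift_on[OF assms(1,2), of t UNIV UNIV h] assms(3)
  by (simp add: tensor_sub_UNIV)

lemma functional_tensor_eq:
  assumes "functional \<alpha>" "functional \<beta>" "\<And>a b. \<alpha> (a \<otimes> b) = \<beta> (a \<otimes> b)"
  shows "\<alpha> t = \<beta> t"
proof -
  have "t \<in> tensor_sub UNIV UNIV" by (simp add: tensor_sub_UNIV)
  then show ?thesis unfolding tensor_sub_def
  proof (induction rule: cvec.span_induct)
    case base
    show ?case
      using assms(1,2) by (intro cvec.subspaceI) (auto simp: functional_zero functional_add functional_cscale)
  qed (use assms(3) in auto)
qed

text \<open>This is the functional \<phi> \<otimes> \<psi>. It is again a functional, so the
  construction can be iterated to test threefold tensors.\<close>

definition tensor_eval ::
    "('a::pd_module \<Rightarrow> complex) \<Rightarrow> ('b::pd_module \<Rightarrow> complex) \<Rightarrow> ('a, 'b) tensor \<Rightarrow> complex"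
  where "tensor_eval \<phi> \<psi> = bilinear_eval (\<lambda>a b. \<phi> a * \<psi> b)"

lemma bilinear_over_mult:
  "functional \<phi> \<Longrightarrow> functional \<psi> \<Longrightarrow> bilinear_over (*) (\<lambda>a b. \<phi> a * \<psi> b)"
  by (auto simp: bilinear_over_def functional_add functional_cscale algebra_simps)

lemma functional_tensor_eval:
  "functional \<phi> \<Longrightarrow> functional \<psi> \<Longrightarrow> functional (tensor_eval \<phi> \<psi>)"
  unfolding tensor_eval_def by (intro functional_bilinear_eval bilinear_over_mult)

lemma tensor_eval_pure:
  "functional \<phi> \<Longrightarrow> functional \<psi> \<Longrightarrow> tensor_eval \<phi> \<psi> (a \<otimes> b) = \<phi> a * \<psi> b"
  unfolding tensor_eval_def by (intro bilinear_eval_pure bilinear_over_mult)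

lemma tensor_eval_swap:
  assumes "functional \<phi>" "functional \<psi>"
  shows "tensor_eval \<phi> \<psi> (tensor_swap t) = tensor_eval \<psi> \<phi> t"
  unfolding tensor_swap_def tensor_eval_def[of \<psi> \<phi>]
  by (intro functional_tensor_lift functional_tensor_eval bilinear_over_mult assms)
    (simp add: tensor_eval_pure assms)

text \<open>Regrouping tensors amounts to regrouping functionals. The nested lifts in
  \<open>tensor_assoc\<close> are evaluated from the inside, with the first factor \<open>a\<close>
  fixed.\<close>

lemma tensor_eval_assoc:
  assumes "functional \<phi>" "functional \<psi>" "functional \<chi>"
  shows "tensor_eval (tensor_eval \<phi> \<psi>) \<chi> (tensor_assoc t) = tensor_eval \<phi> (tensor_eval \<psi> \<chi>) t"
proof -
  have f: "functional (\<lambda>s. \<phi> a * tensor_eval \<psi> \<chi> s)" for a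
    using functional_tensor_eval[OF assms(2,3)]
    by (auto simp: functional_def algebra_simps)
  have inner: "tensor_eval (tensor_eval \<phi> \<psi>) \<chi> (tensor_lift (\<lambda>b c. (a \<otimes> b) \<otimes> c) s)
      = \<phi> a * tensor_eval \<psi> \<chi> s" for a s
  proof -
    have b: "bilinear_over (*) (\<lambda>b c. \<phi> a * (\<psi> b * \<chi> c))"
      using assms by (auto simp: bilinear_over_def functional_add functional_cscale algebra_simps)
    have "tensor_eval (tensor_eval \<phi> \<psi>) \<chi> (tensor_lift (\<lambda>b c. (a \<otimes> b) \<otimes> c) s)
        = bilinear_eval (\<lambda>b c. \<phi> a * (\<psi> b * \<chi> c)) s"
      by (intro functional_tensor_lift b functional_tensor_eval assms)
        (simp add: tensor_eval_pure functional_tensor_eval assms)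
    also have "\<dots> = \<phi> a * tensor_eval \<psi> \<chi> s"
      by (rule functional_tensor_eq[OF functional_bilinear_eval[OF b] f])
        (simp add: bilinear_eval_pure[OF b] tensor_eval_pure assms)
    finally show ?thesis .
  qed
  show ?thesis
    unfolding tensor_assoc_def tensor_eval_def[of \<phi> "tensor_eval \<psi> \<chi>"]
    by (intro functional_tensor_lift functional_tensor_eval bilinear_over_mult assms inner)
qed

text \<open>A coproduct behaves linearly only on its submodule, so its pullback of a functional is
  compared there, on \<open>A\<close> or \<open>B\<close>, with a functional \<phi>' or \<psi>' of
  the whole module.\<close>

lemma tensor_eval_map_on:
  assumes "functional \<phi>" "functional \<psi>" "functional \<phi>'" "functional \<psi>'" "t \<in> tensor_sub A B"
    and "\<And>a. a \<in> A \<Longrightarrow> \<phi> (g a) = \<phi>' a" "\<And>b. b \<in> B \<Longrightarrow> \<psi> (h b) = \<psi>' b"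
  shows "tensor_eval \<phi> \<psi> (tensor_map_on A B g h t) = tensor_eval \<phi>' \<psi>' t"
  unfolding tensor_map_on_def tensor_eval_def[of \<phi>' \<psi>']
  by (intro functional_tensor_lift_on functional_tensor_eval bilinear_over_mult assms)
    (simp add: tensor_eval_pure assms)

section \<open>Families of functionals that separate points\<close>

definition separating :: "('a::pd_module \<Rightarrow> complex) set \<Rightarrow> bool"
  where "separating \<Phi> \<longleftrightarrow> (\<forall>\<phi>\<in>\<Phi>. functional \<phi>) \<and> (\<forall>a. (\<forall>\<phi>\<in>\<Phi>. \<phi> a = 0) \<longrightarrow> a = 0)"

lemma separating_eqI:
  assumes "separating \<Phi>" "\<And>\<phi>. \<phi> \<in> \<Phi> \<Longrightarrow> \<phi> a = \<phi> b"
  shows "a = b"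
proof -
  have "\<forall>\<phi>\<in>\<Phi>. \<phi> (a - b) = 0"
    using assms by (simp add: separating_def functional_diff)
  then have "a - b = 0"
    using assms(1) unfolding separating_def by blast
  then show ?thesis by simp
qed

text \<open>Expanding every first factor in one complex basis and collecting terms turns the second
  factors into coordinates, which can be tested one at a time.\<close>

lemma tensor_independent_expansion:
  fixes t :: "('a::pd_module, 'b::pd_module) tensor"
  shows "\<exists>B h. finite B \<and> cvec.independent B \<and> t = (\<Sum>b\<in>B. b \<otimes> h b)"
proof -
  obtain B0 :: "'a set" where B0: "cvec.independent B0" "UNIV \<subseteq> cvec.span B0"
    using cvec.basis_exists[of UNIV] by auto
  have zero: "b \<otimes> 0 = (0 :: ('a, 'b) tensor)" for b
    using pure_tensor_bilinear(2)[of b 0 0] by simp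
  \<comment> \<open>All first factors stay in the fixed basis \<open>B0\<close>: two expansions can
    then be padded with zeros to the union of their index sets, which is still independent.\<close>
  let ?P = "\<lambda>t::('a,'b) tensor. \<exists>B h. finite B \<and> B \<subseteq> B0 \<and> t = (\<Sum>b\<in>B. b \<otimes> h b)"
  have ext: "\<exists>h'. (\<Sum>b\<in>B. b \<otimes> h b) = (\<Sum>b\<in>C. b \<otimes> h' b)"
    if "finite C" "B \<subseteq> C" for B C :: "'a set" and h :: "'a \<Rightarrow> 'b"
    using that
    by (intro exI[of _ "\<lambda>b. if b \<in> B then h b else 0"] sum.mono_neutral_cong_left)
      (auto simp: zero)
  have add: "?P (s + t)" if "?P s" "?P t" for s t
  proof -
    from that obtain B h C k where *: "finite B" "B \<subseteq> B0" "s = (\<Sum>b\<in>B. b \<otimes> h b)"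
      "finite C" "C \<subseteq> B0" "t = (\<Sum>b\<in>C. b \<otimes> k b)" by blast
    have fin: "finite (B \<union> C)" "B \<union> C \<subseteq> B0" using * by auto
    obtain h' where "s = (\<Sum>b\<in>B\<union>C. b \<otimes> h' b)"
      using ext[OF fin(1) Un_upper1, of h] *(3) by metis
    moreover obtain k' where "t = (\<Sum>b\<in>B\<union>C. b \<otimes> k' b)"
      using ext[OF fin(1) Un_upper2, of k] *(6) by metis
    ultimately have "s + t = (\<Sum>b\<in>B\<union>C. b \<otimes> (h' b + k' b))"
      by (simp add: pure_tensor_bilinear sum.distrib)
    with fin show ?thesis by (intro exI conjI)
  qed
  have scale: "?P (c \<cdot>\<^sub>\<complex> t)" if "?P t" for c t
  proof -
    from that obtain B h where *: "finite B" "B \<subseteq> B0" "t = (\<Sum>b\<in>B. b \<otimes> h b)" by blast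
    then have "c \<cdot>\<^sub>\<complex> t = (\<Sum>b\<in>B. b \<otimes> (c \<cdot>\<^sub>\<complex> h b))"
      by (simp add: cvec.scale_sum_right pure_tensor_bilinear flip: cscale_tensor)
    with *(1,2) show ?thesis by (intro exI conjI)
  qed
  have pure: "?P (a \<otimes> v)" for a v
  proof -
    have "a \<in> cvec.span B0" using B0 by auto
    then obtain F u where F: "finite F" "F \<subseteq> B0" "a = (\<Sum>b\<in>F. u b \<cdot>\<^sub>\<complex> b)"
      unfolding cvec.span_explicit by blast
    have "(\<Sum>b\<in>F. u b \<cdot>\<^sub>\<complex> b) \<otimes> v = (\<Sum>b\<in>F. b \<otimes> (u b \<cdot>\<^sub>\<complex> v))"
    proof -
      have z: "0 \<otimes> v = (0 :: ('a, 'b) tensor)"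
        using pure_tensor_bilinear(1)[of 0 0 v] by simp
      show ?thesis using \<open>finite F\<close>
        by (induction F rule: finite_induct) (simp_all add: z pure_tensor_bilinear)
    qed
    with F show ?thesis by (intro exI[of _ F] exI conjI) simp_all
  qed
  have "t \<in> tensor_sub UNIV UNIV" by (simp add: tensor_sub_UNIV)
  then have "?P t"
    unfolding tensor_sub_def
  proof (induction rule: cvec.span_induct)
    case base
    show "cvec.subspace {t. ?P t}"
    proof (rule cvec.subspaceI)
      show "0 \<in> {t. ?P t}" by (auto intro!: exI[of _ "{}"])
    qed (simp_all only: mem_Collect_eq add scale)
  next
    case (step t)
    then obtain a b where "t = a \<otimes> b" by blast
    then show ?case by (simp only: pure)
  qed
  then show ?thesis
    using cvec.independent_mono[OF B0(1)] by blast
qed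

text \<open>Write \<open>t\<close> as a sum of \<open>b \<otimes> h b\<close> with independent
  \<open>b\<close> and fix \<psi>. The value of \<phi> \<otimes> \<psi> at \<open>t\<close> is
  \<phi> of the vector with coordinates \<open>\<psi> (h b)\<close>, so that vector is 0 and by
  independence all \<open>\<psi> (h b)\<close> are 0; letting \<psi> vary gives
  \<open>h b = 0\<close>.\<close>

lemma separating_tensor:
  fixes \<Phi> :: "('a::pd_module \<Rightarrow> complex) set" and \<Psi> :: "('b::pd_module \<Rightarrow> complex) set"
  assumes "separating \<Phi>" "separating \<Psi>"
  shows "separating {tensor_eval \<phi> \<psi> |\<phi> \<psi>. \<phi> \<in> \<Phi> \<and> \<psi> \<in> \<Psi>}"
  unfolding separating_def
proof (intro conjI allI impI ballI)
  fix \<chi> assume "\<chi> \<in> {tensor_eval \<phi> \<psi> |\<phi> \<psi>. \<phi> \<in> \<Phi> \<and> \<psi> \<in> \<Psi>}"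
  then show "functional \<chi>"
    using assms by (auto simp: separating_def intro: functional_tensor_eval)
next
  fix t :: "('a, 'b) tensor"
  assume *: "\<forall>\<chi>\<in>{tensor_eval \<phi> \<psi> |\<phi> \<psi>. \<phi> \<in> \<Phi> \<and> \<psi> \<in> \<Psi>}. \<chi> t = 0"
  obtain B h where B: "finite B" "cvec.independent B" "t = (\<Sum>b\<in>B. b \<otimes> h b)"
    using tensor_independent_expansion by blast
  have "\<psi> (h b) = 0" if \<psi>: "\<psi> \<in> \<Psi>" and b: "b \<in> B" for \<psi> b
  proof -
    have f\<psi>: "functional \<psi>" using assms \<psi> by (simp add: separating_def)
    have "(\<Sum>b\<in>B. \<psi> (h b) \<cdot>\<^sub>\<complex> b) = 0"
    proof (rule separating_eqI[OF assms(1)])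
      fix \<phi> assume \<phi>: "\<phi> \<in> \<Phi>"
      then have f\<phi>: "functional \<phi>" using assms by (simp add: separating_def)
      have "0 = tensor_eval \<phi> \<psi> t"
        using * \<phi> \<psi> by auto
      also have "\<dots> = (\<Sum>b\<in>B. \<phi> b * \<psi> (h b))"
        unfolding B(3) functional_sum[OF functional_tensor_eval[OF f\<phi> f\<psi>]]
        by (simp add: tensor_eval_pure f\<phi> f\<psi>)
      finally show "\<phi> (\<Sum>b\<in>B. \<psi> (h b) \<cdot>\<^sub>\<complex> b) = \<phi> 0"
        by (simp add: functional_sum[OF f\<phi>] functional_cscale[OF f\<phi>] functional_zero[OF f\<phi>] mult.commute)
    qed
    then show ?thesis
      by (rule cvec.independentD[OF B(2,1) subset_refl _ b])
  qed
  then have "h b = 0" if "b \<in> B" for b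
    using assms(2) that by (simp add: separating_def)
  moreover have "b \<otimes> 0 = (0 :: ('a, 'b) tensor)" for b
    using pure_tensor_bilinear(2)[of b 0 0] by simp
  ultimately show "t = 0"
    by (simp add: B(3))
qed

section \<open>The conformal dual as a space of sequences\<close>

lemma pscale_pCons: "pCons c p \<cdot>\<^sub>\<partial> x = c \<cdot>\<^sub>\<complex> x + \<partial> (p \<cdot>\<^sub>\<partial> x)"
proof -
  have "pCons c p = [:c:] + [:0, 1:] * p" by simp
  then show ?thesis
    by (simp only: cscale_def pd_deriv_def pd.scale_left_distrib pd.scale_scale)
qed

lemma pd_deriv_zero: "\<partial> 0 = 0"
  by (simp add: pd_deriv_def)

lemma pd_subspaceI:
  assumes "0 \<in> S" "\<And>x y. x \<in> S \<Longrightarrow> y \<in> S \<Longrightarrow> x + y \<in> S"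
    and "\<And>c x. x \<in> S \<Longrightarrow> c \<cdot>\<^sub>\<complex> x \<in> S" "\<And>x. x \<in> S \<Longrightarrow> \<partial> x \<in> S"
  shows "pd.subspace S"
proof (rule pd.subspaceI)
  show "p \<cdot>\<^sub>\<partial> x \<in> S" if "x \<in> S" for p x
    by (induction p) (use assms that in \<open>simp_all add: pscale_pCons\<close>)
qed (use assms in auto)

lemma pd_subspace_imp_cvec_subspace: "pd.subspace S \<Longrightarrow> cvec.subspace S"
  by (auto simp: pd.subspace_def cvec.subspace_def cscale_def)

lemma cscale_in_subspace_iff:
  fixes x :: "'a::pd_module"
  assumes "pd.subspace S" "c \<noteq> 0"
  shows "c \<cdot>\<^sub>\<complex> x \<in> S \<longleftrightarrow> x \<in> S"
proof
  note S = pd_subspace_imp_cvec_subspace[OF assms(1)]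
  assume "c \<cdot>\<^sub>\<complex> x \<in> S"
  then have "inverse c \<cdot>\<^sub>\<complex> c \<cdot>\<^sub>\<complex> x \<in> S"
    by (rule cvec.subspace_scale[OF S])
  then show "x \<in> S" using assms(2) by simp
qed (rule cvec.subspace_scale[OF pd_subspace_imp_cvec_subspace[OF assms(1)]])

lemma pd_subspace_deriv: "pd.subspace S \<Longrightarrow> x \<in> S \<Longrightarrow> \<partial> x \<in> S"
  by (auto simp: pd_deriv_def intro: pd.subspace_scale)

lemma dual_apply_add_left: "dual_apply (f + g) u = dual_apply f u + dual_apply g u"
  by transfer simp

lemma dual_apply_diff_left: "dual_apply (f - g) u = dual_apply f u - dual_apply g u"
  by transfer simp

lemma dual_apply_zero_left: "dual_apply 0 u = 0"
  by transfer simp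

lemma dual_apply_sum_left: "dual_apply (sum f A) u = (\<Sum>k\<in>A. dual_apply (f k) u)"
  by (induction A rule: infinite_finite_induct) (simp_all add: dual_apply_zero_left dual_apply_add_left)

lemma dual_apply_pscale_left: "dual_apply (p \<cdot>\<^sub>\<partial> f) u = pcompose p [:0, -1:] * dual_apply f u"
  by transfer simp

lemma dual_apply_cscale_left: "dual_apply (c \<cdot>\<^sub>\<complex> f) u = smult c (dual_apply f u)"
  by (simp add: cscale_def dual_apply_pscale_left)

lemma conformal_functional_dual_apply: "conformal_functional (dual_apply f)"
  using dual_apply[of f] by simp

lemma dual_apply_add: "dual_apply f (u + v) = dual_apply f u + dual_apply f v"
  and dual_apply_cscale: "dual_apply f (c \<cdot>\<^sub>\<complex> u) = smult c (dual_apply f u)"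
  and dual_apply_pd_deriv: "dual_apply f (\<partial> u) = [:0, 1:] * dual_apply f u"
  using conformal_functional_dual_apply[of f] by (simp_all add: conformal_functional_def)

lemma dual_apply_zero: "dual_apply f 0 = 0"
  using dual_apply_cscale[of f 0 0] by simp

lemma dual_apply_neg: "dual_apply f (- u) = - dual_apply f u"
  by (metis add_eq_0_iff dual_apply_add dual_apply_zero add.right_inverse)

lemma dual_apply_pscale: "dual_apply f (p \<cdot>\<^sub>\<partial> u) = p * dual_apply f u"
  by (induction p) (simp_all add: dual_apply_zero pscale_pCons dual_apply_add dual_apply_cscale dual_apply_pd_deriv)

lemma dual_eqI: "(\<And>u. dual_apply f u = dual_apply g u) \<Longrightarrow> f = g"
  by (metis dual_apply_inject ext)

text \<open>Evaluation at a number turns polynomial values into complex functionals, to which the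
  tensor calculus applies; \<partial> becomes multiplication by \<open>- x\<close>.\<close>

definition point_eval :: "'l::pd_module \<Rightarrow> complex \<Rightarrow> 'l cdual \<Rightarrow> complex"
  where "point_eval u x f = poly (dual_apply f u) x"

lemma functional_point_eval: "functional (point_eval u x)"
  by (simp add: functional_def point_eval_def dual_apply_add_left dual_apply_cscale_left)

lemma point_eval_pscale: "point_eval u x (p \<cdot>\<^sub>\<partial> f) = poly p (- x) * point_eval u x f"
  by (simp add: point_eval_def dual_apply_pscale_left poly_pcompose)

lemma point_eval_deriv: "point_eval u x (\<partial> f) = - x * point_eval u x f"
  by (simp add: pd_deriv_def point_eval_pscale)

lemma point_eval_arg:
  "point_eval (u + v) x f = point_eval u x f + point_eval v x f"
  "point_eval (c \<cdot>\<^sub>\<complex> u) x f = c * point_eval u x f"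
  "point_eval (\<partial> u) x f = x * point_eval u x f"
  "point_eval 0 x f = 0"
  by (simp_all add: point_eval_def dual_apply_add dual_apply_cscale dual_apply_pd_deriv dual_apply_zero)

text \<open>By the Leibniz rule on a pure tensor, \<partial> contributes \<open>- x\<close> from the
  first factor and \<open>- y\<close> from the second.\<close>

lemma tensor_eval_pscale:
  "tensor_eval (point_eval u x) (point_eval v y) (p \<cdot>\<^sub>\<partial> t) =
    poly p (- (x + y)) * tensor_eval (point_eval u x) (point_eval v y) t"
proof -
  let ?\<phi> = "tensor_eval (point_eval u x) (point_eval v y)"
  have f: "functional ?\<phi>"
    by (intro functional_tensor_eval functional_point_eval)
  have deriv: "?\<phi> (\<partial> s) = - (x + y) * ?\<phi> s" for s
  proof (rule functional_tensor_eq)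
    show "functional (\<lambda>s. ?\<phi> (\<partial> s))" "functional (\<lambda>s. - (x + y) * ?\<phi> s)"
      using f by (auto simp: functional_def pd_deriv_add pd_deriv_cscale algebra_simps)
  qed (simp add: deriv_tensor tensor_deriv_pure functional_add[OF f] tensor_eval_pure
      functional_point_eval point_eval_deriv algebra_simps)
  show ?thesis
    by (induction p) (simp_all add: functional_zero[OF f] pscale_pCons functional_add[OF f]
        functional_cscale[OF f] deriv algebra_simps)
qed

text \<open>Scalars can be absorbed into the first factors because \<open>W\<close> is closed under
  scaling. This matches the span with the finite sums in \<open>is_coproduct\<close>.\<close>

lemma tensor_sub_sum_iff:
  assumes "cvec.subspace W"
  shows "t \<in> tensor_sub W W \<longleftrightarrow>
    (\<exists>(n::nat) g h. (\<forall>k<n. g k \<in> W \<and> h k \<in> W) \<and> t = (\<Sum>k<n. g k \<otimes> h k))"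
proof
  assume "t \<in> tensor_sub W W"
  then show "\<exists>(n::nat) g h. (\<forall>k<n. g k \<in> W \<and> h k \<in> W) \<and> t = (\<Sum>k<n. g k \<otimes> h k)"
    unfolding tensor_sub_def
  proof (induction rule: cvec.span_induct_alt)
    case base
    show ?case by (intro exI[of _ 0]) simp
  next
    case (step c s t)
    then obtain n g h where *: "\<forall>k<n::nat. g k \<in> W \<and> h k \<in> W" "t = (\<Sum>k<n. g k \<otimes> h k)" by blast
    obtain a b where ab: "s = a \<otimes> b" "a \<in> W" "b \<in> W" using step by blast
    have "c \<cdot>\<^sub>\<complex> s + t = (\<Sum>k<Suc n. (g(n := c \<cdot>\<^sub>\<complex> a)) k \<otimes> (h(n := b)) k)"
      by (simp add: ab(1) *(2) pure_tensor_bilinear cscale_tensor)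
    then show ?case
      using *(1) ab(2,3) cvec.subspace_scale[OF assms]
      by (intro exI[of _ "Suc n"] exI[of _ "g(n := c \<cdot>\<^sub>\<complex> a)"] exI[of _ "h(n := b)"])
        (auto simp: less_Suc_eq)
  qed
next
  assume "\<exists>(n::nat) g h. (\<forall>k<n. g k \<in> W \<and> h k \<in> W) \<and> t = (\<Sum>k<n. g k \<otimes> h k)"
  then show "t \<in> tensor_sub W W"
    by (auto intro!: cvec.subspace_sum[OF subspace_tensor_sub] tensor_sub_pure)
qed

lemma tensor_sub_pscale:
  assumes "pd.subspace W" "t \<in> tensor_sub W W"
  shows "p \<cdot>\<^sub>\<partial> t \<in> tensor_sub W W"
proof -
  have deriv: "\<partial> s \<in> tensor_sub W W" if s: "s \<in> tensor_sub W W" for s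
    using s unfolding tensor_sub_def
  proof (induction rule: cvec.span_induct)
    case base
    show ?case
      by (rule cvec.subspaceI)
        (simp_all add: pd_deriv_add pd_deriv_cscale pd_deriv_zero cvec.span_zero cvec.span_add cvec.span_scale)
  next
    case (step s)
    then obtain a b where "s = a \<otimes> b" "a \<in> W" "b \<in> W" by blast
    then show ?case
      unfolding tensor_sub_def[symmetric]
      by (auto simp: deriv_tensor tensor_deriv_pure intro!: tensor_sub_pure
          cvec.subspace_add[OF subspace_tensor_sub] pd_subspace_deriv[OF assms(1)])
  qed
  show ?thesis
    by (induction p) (use assms deriv in \<open>auto simp: pscale_pCons cvec.subspace_0[OF subspace_tensor_sub]
        intro!: cvec.subspace_add[OF subspace_tensor_sub] cvec.subspace_scale[OF subspace_tensor_sub]\<close>)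
qed

section \<open>Functionals on a free module as sequences of polynomials\<close>

locale free_generators =
  fixes Lg :: "nat \<Rightarrow> 'l::pd_module"
  assumes basis: "pd_basis Lg UNIV UNIV"
begin

lemma generators_induct [case_names zero add cscale deriv generator]:
  assumes "P 0" "\<And>u v. P u \<Longrightarrow> P v \<Longrightarrow> P (u + v)" "\<And>c u. P u \<Longrightarrow> P (c \<cdot>\<^sub>\<complex> u)"
    and "\<And>u. P u \<Longrightarrow> P (\<partial> u)" "\<And>i. P (Lg i)"
  shows "P u"
proof -
  have "u \<in> pd.span (range Lg)"
    using basis by (simp add: pd_basis_def)
  then show ?thesis
  proof (induction rule: pd.span_induct)
    case base
    show ?case by (rule pd_subspaceI) (use assms in auto)
  qed (use assms in auto)
qed

lemma dual_eq_generatorsI: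
  assumes "\<And>i. dual_apply f (Lg i) = dual_apply g (Lg i)"
  shows "f = g"
proof (rule dual_eqI)
  show "dual_apply f u = dual_apply g u" for u
    by (induction u rule: generators_induct)
      (simp_all add: dual_apply_zero dual_apply_add dual_apply_cscale dual_apply_pd_deriv assms)
qed

text \<open>Freeness gives each \<open>u\<close> unique coefficients with respect to the generators.
  Reading a coefficient in \<partial> as the same polynomial in \<lambda> and multiplying it by the
  prescribed value yields a conformal functional.\<close>

lemma ex_dual: "\<exists>f. \<forall>i. dual_apply f (Lg i) = G i"
proof -
  have inj: "inj Lg" and indep: "pd.independent (range Lg)" and span: "\<And>u. u \<in> pd.span (range Lg)"
    using basis by (auto simp: pd_basis_def)
  let ?r = "pd.representation (range Lg)"
  define F where "F u = (\<Sum>b | ?r u b \<noteq> 0. ?r u b * G (inv Lg b))" for u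
  have F: "F u = (\<Sum>b\<in>B. ?r u b * G (inv Lg b))" if "finite B" "{b. ?r u b \<noteq> 0} \<subseteq> B" for u B
    unfolding F_def using that by (intro sum.mono_neutral_left) auto
  have fin: "finite {b. ?r u b \<noteq> 0}" for u
    by (rule pd.finite_representation)
  have add: "F (u + v) = F u + F v" for u v
  proof -
    \<comment> \<open>Cancellation can shrink the support of \<open>u + v\<close>, so all three sums
      are taken over the union of the two supports.\<close>
    let ?B = "{b. ?r u b \<noteq> 0} \<union> {b. ?r v b \<noteq> 0}"
    have r: "?r (u + v) = (\<lambda>b. ?r u b + ?r v b)"
      by (rule pd.representation_add[OF indep span span])
    have "F (u + v) = (\<Sum>b\<in>?B. ?r (u + v) b * G (inv Lg b))"
      by (rule F) (use fin in \<open>auto simp: r\<close>)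
    also have "\<dots> = F u + F v"
      by (simp add: F[of ?B] fin r sum.distrib algebra_simps)
    finally show ?thesis .
  qed
  have scale: "F (p \<cdot>\<^sub>\<partial> u) = p * F u" for p u
  proof -
    have r: "?r (p \<cdot>\<^sub>\<partial> u) = (\<lambda>b. p * ?r u b)"
      by (rule pd.representation_scale[OF indep span])
    have "F (p \<cdot>\<^sub>\<partial> u) = (\<Sum>b | ?r u b \<noteq> 0. ?r (p \<cdot>\<^sub>\<partial> u) b * G (inv Lg b))"
      by (rule F) (use fin in \<open>auto simp: r\<close>)
    then show ?thesis
      by (simp add: r F_def sum_distrib_left algebra_simps)
  qed
  have "F (Lg i) = G i" for i
    by (simp add: F_def pd.representation_basis[OF indep] inv_f_f[OF inj])
  moreover have "conformal_functional F"
    unfolding conformal_functional_def cscale_def pd_deriv_def by (simp add: add scale)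
  ultimately show ?thesis
    by (intro exI[of _ "Abs_cdual F"]) (simp add: Abs_cdual_inverse)
qed

text \<open>By \<open>dual_eq_generatorsI\<close> the chosen functional is the only one, so this
  inverts the passage from a functional to its sequence of values.\<close>

definition seq_dual :: "(nat \<Rightarrow> complex poly) \<Rightarrow> 'l cdual"
  where "seq_dual G = (SOME f. \<forall>i. dual_apply f (Lg i) = G i)"

lemma dual_apply_seq_dual [simp]: "dual_apply (seq_dual G) (Lg i) = G i"
  using someI_ex[OF ex_dual[of G]] by (simp add: seq_dual_def)

lemma dual_gen_eq: "dual_gen Lg j = seq_dual (\<lambda>i. if i = j then 1 else 0)"
  unfolding dual_gen_def
proof (rule the_equality)
  fix f assume *: "\<forall>p i. dual_apply f (p \<cdot>\<^sub>\<partial> Lg i) = (if i = j then p else 0)"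
  show "f = seq_dual (\<lambda>i. if i = j then 1 else 0)"
    by (rule dual_eq_generatorsI) (use *[rule_format, of 1] in simp)
qed (simp add: dual_apply_pscale)

lemma exp_poly_dual_eq: "exp_poly_dual Lg a m = seq_dual (\<lambda>i. [:a ^ i * of_nat i ^ m:])"
  unfolding exp_poly_dual_def
proof (rule the_equality)
  fix f assume "\<forall>i. dual_apply f (Lg i) = [:a ^ i * of_nat i ^ m:]"
  then show "f = seq_dual (\<lambda>i. [:a ^ i * of_nat i ^ m:])"
    by (intro dual_eq_generatorsI) simp
qed simp

lemma dual_apply_dual_gen [simp]: "dual_apply (dual_gen Lg j) (Lg i) = (if i = j then 1 else 0)"
  by (simp add: dual_gen_eq)

lemma dual_apply_exp_poly_dual [simp]:
  "dual_apply (exp_poly_dual Lg a m) (Lg i) = [:a ^ i * of_nat i ^ m:]"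
  by (simp add: exp_poly_dual_eq)

abbreviation gen_eval :: "nat \<Rightarrow> complex \<Rightarrow> 'l cdual \<Rightarrow> complex"
  where "gen_eval i x \<equiv> point_eval (Lg i) x"

text \<open>The generators determine a functional, and a complex polynomial is determined by its
  values at all points.\<close>

lemma separating_gen_eval: "separating {gen_eval i x |i x. True}"
  unfolding separating_def
proof (intro conjI ballI allI impI)
  fix f assume *: "\<forall>\<phi>\<in>{gen_eval i x |i x. True}. \<phi> f = 0"
  show "f = 0"
  proof (rule dual_eq_generatorsI)
    fix i
    have "poly (dual_apply f (Lg i)) x = 0" for x
    proof -
      have "gen_eval i x f = 0" using * by blast
      then show ?thesis by (simp add: point_eval_def)
    qed
    then show "dual_apply f (Lg i) = dual_apply 0 (Lg i)"
      unfolding dual_apply_zero_left poly_eq_poly_eq_iff[symmetric] by auto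
  qed
qed (auto simp: functional_point_eval)

abbreviation gen_eval2 :: "nat \<Rightarrow> complex \<Rightarrow> nat \<Rightarrow> complex \<Rightarrow> ('l cdual, 'l cdual) tensor \<Rightarrow> complex"
  where "gen_eval2 i x j y \<equiv> tensor_eval (gen_eval i x) (gen_eval j y)"

lemma functional_gen_eval2: "functional (gen_eval2 i x j y)"
  by (intro functional_tensor_eval functional_point_eval)

lemma gen_eval2_eqI:
  assumes "\<And>i x j y. gen_eval2 i x j y s = gen_eval2 i x j y t"
  shows "s = t"
  by (rule separating_eqI[OF separating_tensor[OF separating_gen_eval separating_gen_eval]])
    (elim CollectE exE conjE; simp only: assms)

lemma gen_eval3_eqI:
  assumes "\<And>i x j y k z. tensor_eval (gen_eval2 i x j y) (gen_eval k z) s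
      = tensor_eval (gen_eval2 i x j y) (gen_eval k z) t"
  shows "s = t"
  by (rule separating_eqI[OF separating_tensor[OF
          separating_tensor[OF separating_gen_eval separating_gen_eval] separating_gen_eval]])
    (elim CollectE exE conjE; simp only: assms)

end

section \<open>Coproducts and good submodules\<close>

text \<open>Homogeneous linear equations, fewer than the unknowns, have a nontrivial solution.
  Gaussian elimination: the last equation is either vacuous or eliminates one unknown
  \<open>s0\<close> from the others.\<close>

lemma ex_nontrivial_relation:
  fixes G :: "'s \<Rightarrow> nat \<Rightarrow> 'k::field"
  assumes "finite S" "n < card S"
  shows "\<exists>\<beta>. (\<exists>s\<in>S. \<beta> s \<noteq> 0) \<and> (\<forall>k<n. (\<Sum>s\<in>S. \<beta> s * G s k) = 0)"
  using assms
proof (induction n arbitrary: S G)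
  case 0
  then obtain s where "s \<in> S" by fastforce
  then show ?case by (intro exI[of _ "\<lambda>_. 1"]) auto
next
  case (Suc n)
  show ?case
  proof (cases "\<forall>s\<in>S. G s n = 0")
    case True
    obtain \<beta> where "\<exists>s\<in>S. \<beta> s \<noteq> 0" "\<forall>k<n. (\<Sum>s\<in>S. \<beta> s * G s k) = 0"
      using Suc.IH[of S G] Suc.prems by auto
    then show ?thesis
      using True by (intro exI[of _ \<beta>]) (auto simp: less_Suc_eq)
  next
    case False
    then obtain s0 where s0: "s0 \<in> S" "G s0 n \<noteq> 0" by blast
    let ?S = "S - {s0}"
    have "finite ?S" "n < card ?S"
      using Suc.prems s0(1) by auto
    from Suc.IH[OF this, of "\<lambda>s k. G s k - G s n / G s0 n * G s0 k"]
    obtain \<beta> where \<beta>: "\<exists>s\<in>?S. \<beta> s \<noteq> 0"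
      "\<And>k. k < n \<Longrightarrow> (\<Sum>s\<in>?S. \<beta> s * (G s k - G s n / G s0 n * G s0 k)) = 0"
      by blast
    \<comment> \<open>This value of the unknown \<open>s0\<close> solves equation \<open>n\<close>;
      the eliminated form of the other equations then gives back the original ones.\<close>
    define c where "c = - (\<Sum>s\<in>?S. \<beta> s * G s n) / G s0 n"
    have sum: "(\<Sum>s\<in>S. (\<beta>(s0 := c)) s * G s k) = (\<Sum>s\<in>?S. \<beta> s * G s k) + c * G s0 k" for k
      using Suc.prems(1) s0(1) by (simp add: sum.remove[of S s0])
    have "(\<Sum>s\<in>S. (\<beta>(s0 := c)) s * G s k) = 0" if "k < Suc n" for k
    proof (cases "k = n")
      case True
      then show ?thesis unfolding sum using s0(2) by (simp add: c_def)
    next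
      case False
      with that have "(\<Sum>s\<in>?S. \<beta> s * (G s k - G s n / G s0 n * G s0 k)) = 0"
        using \<beta>(2) by simp
      then show ?thesis
        unfolding sum unfolding c_def
        by (simp add: right_diff_distrib sum_subtractf sum_distrib_right sum_divide_distrib mult.assoc)
    qed
    then show ?thesis
      using \<beta>(1) by (intro exI[of _ "\<beta>(s0 := c)"]) auto
  qed
qed

text \<open>For each \<open>m\<close> the one-variable polynomials \<open>poly P [:m:]\<close> and
  \<open>poly Q [:m:]\<close> agree. Hence \<open>P - Q\<close> has infinitely many roots in an
  integral domain.\<close>

lemma poly2_eqI:
  fixes P Q :: "complex poly poly"
  assumes "\<And>l m. poly (poly P [:m:]) l = poly (poly Q [:m:]) l"
  shows "P = Q"
proof (rule ccontr)
  assume "P \<noteq> Q"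
  then have "finite {z. poly (P - Q) z = 0}"
    by (intro poly_roots_finite) simp
  moreover have "range (\<lambda>m. [:m:]) \<subseteq> {z. poly (P - Q) z = 0}"
  proof safe
    fix m :: complex
    have "poly P [:m:] = poly Q [:m:]"
      unfolding poly_eq_poly_eq_iff[symmetric] using assms by auto
    then show "poly (P - Q) [:m:] = 0" by simp
  qed
  ultimately have "finite (range (\<lambda>m::complex. [:m:]))"
    by (rule rev_finite_subset)
  then have "finite (UNIV :: complex set)"
    by (rule finite_imageD) (simp add: inj_on_def)
  then show False
    using infinite_UNIV_char_0 by blast
qed

lemma poly_poly_at: "poly (poly (poly_at p v) [:m:]) l = poly p (poly (poly v [:m:]) l)"
  unfolding poly_at_def by (induction p) (simp_all add: map_poly_pCons)

lemma map_poly_additive: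
  assumes "\<And>x y. h (x + y) = h x + h y" "h 0 = 0"
  shows "map_poly h (p + q) = map_poly h p + map_poly h q"
  by (rule poly_eqI) (simp add: coeff_map_poly assms)

lemma map_poly_dual_apply_add:
  "map_poly (dual_apply f) (p + q) = map_poly (dual_apply f) p + map_poly (dual_apply f) q"
  by (rule map_poly_additive) (simp_all add: dual_apply_add dual_apply_zero)

lemma map_poly_dual_apply_neg: "map_poly (dual_apply f) (- p) = - map_poly (dual_apply f) p"
  by (rule poly_eqI) (simp add: coeff_map_poly dual_apply_zero dual_apply_neg)

lemma map_poly_dual_apply_pCons:
  "map_poly (dual_apply f) (pCons u p) = pCons (dual_apply f u) (map_poly (dual_apply f) p)"
  by (rule poly_eqI) (simp add: coeff_map_poly dual_apply_zero coeff_pCons split: nat.split)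

lemma map_poly_dual_apply_cscale:
  "map_poly (dual_apply f) (map_poly (cscale c) p) = smult [:c:] (map_poly (dual_apply f) p)"
  by (rule poly_eqI) (simp add: coeff_map_poly dual_apply_zero dual_apply_cscale)

lemma map_poly_dual_apply_deriv:
  "map_poly (dual_apply f) (map_poly \<partial> p) = smult [:0, 1:] (map_poly (dual_apply f) p)"
  by (rule poly_eqI) (simp add: coeff_map_poly dual_apply_zero dual_apply_pd_deriv pd_deriv_zero)

section \<open>Coproducts in terms of their values at generators\<close>

locale bracket_algebra = free_generators Lg + lie_conformal_algebra br
  for Lg :: "nat \<Rightarrow> 'l::pd_module" and br :: "'l \<Rightarrow> 'l \<Rightarrow> 'l poly" +
  assumes br_generators: "br (Lg i) (Lg j) = [:\<partial> (Lg (i + j)), 2 \<cdot>\<^sub>\<complex> Lg (i + j):]"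
begin

text \<open>\<open>f\<^sub>\<lambda>([a\<^sub>\<mu> b])\<close> at \<open>\<mu> = -x\<close>, \<open>\<lambda> = x + y\<close>: in these coordinates \<open>\<partial>\<close> on the left and right
  argument is multiplication by \<open>x\<close> and \<open>y\<close>.\<close>

definition bracket_eval :: "'l cdual \<Rightarrow> 'l \<Rightarrow> 'l \<Rightarrow> complex \<Rightarrow> complex \<Rightarrow> complex"
  where "bracket_eval f a b x y = poly (poly (map_poly (dual_apply f) (br a b)) [:- x:]) (x + y)"

lemma br_zero_left: "br 0 b = 0"
  using br_add_left[of 0 0 b] by simp

lemma br_zero_right: "br a 0 = 0"
  using br_add_right[of a 0 0] by simp

lemma bracket_eval_left:
  "bracket_eval f 0 b x y = 0"
  "bracket_eval f (a + a') b x y = bracket_eval f a b x y + bracket_eval f a' b x y"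
  "bracket_eval f (c \<cdot>\<^sub>\<complex> a) b x y = c * bracket_eval f a b x y"
  "bracket_eval f (\<partial> a) b x y = x * bracket_eval f a b x y"
  by (simp_all add: bracket_eval_def br_zero_left br_add_left br_cscale_left br_deriv_left
      map_poly_dual_apply_add map_poly_dual_apply_cscale map_poly_dual_apply_neg
      map_poly_dual_apply_pCons dual_apply_zero)

lemma bracket_eval_right:
  "bracket_eval f a 0 x y = 0"
  "bracket_eval f a (b + b') x y = bracket_eval f a b x y + bracket_eval f a b' x y"
  "bracket_eval f a (c \<cdot>\<^sub>\<complex> b) x y = c * bracket_eval f a b x y"
  "bracket_eval f a (\<partial> b) x y = y * bracket_eval f a b x y"
  by (simp_all add: bracket_eval_def br_zero_right br_add_right br_cscale_right br_deriv_right
      map_poly_dual_apply_add map_poly_dual_apply_cscale map_poly_dual_apply_deriv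
      map_poly_dual_apply_pCons dual_apply_zero algebra_simps)

lemma bracket_eval_generators:
  "bracket_eval f (Lg i) (Lg j) x y = (y - x) * gen_eval (i + j) (x + y) f"
  by (simp add: bracket_eval_def br_generators map_poly_dual_apply_pCons dual_apply_pd_deriv
      dual_apply_cscale point_eval_def algebra_simps)

text \<open>The coproduct condition on generators only. The factor \<open>y - x\<close> is 2\<mu> +
  \<lambda> at \<mu> = -x and \<lambda> = x + y.\<close>

definition has_coproduct :: "'l cdual set \<Rightarrow> 'l cdual \<Rightarrow> ('l cdual, 'l cdual) tensor \<Rightarrow> bool"
  where "has_coproduct W f t \<longleftrightarrow> t \<in> tensor_sub W W \<and>
    (\<forall>i j x y. gen_eval2 i x j y t = (y - x) * gen_eval (i + j) (x + y) f)"

text \<open>Polynomials in two variables may be compared pointwise. Both sides are bilinear and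
  respond in the same way to \<partial> in either argument, so generators suffice.\<close>

lemma is_coproduct_iff:
  assumes "pd.subspace W"
  shows "is_coproduct br W f t \<longleftrightarrow> has_coproduct W f t"
proof -
  have eq: "map_poly (dual_apply f) (br a b) = (\<Sum>k<n. poly_at (dual_apply (g k) a) (- var_mu) *
                 poly_at (dual_apply (h k) b) (var_lam + var_mu)) \<longleftrightarrow>
     (\<forall>x y. bracket_eval f a b x y = (\<Sum>k<n. point_eval a x (g k) * point_eval b y (h k)))"
    (is "?L = ?R \<longleftrightarrow> ?E") for n :: nat and g h a b
  proof
    assume *: "?L = ?R"
    show ?E
      by (simp add: bracket_eval_def * poly_sum poly_poly_at point_eval_def)
  next
    assume ?E
    show "?L = ?R"
    proof (rule poly2_eqI)
      fix l m
      \<comment> \<open>The change of coordinates is inverted here: x = -\<mu> and y = \<lambda> +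
        \<mu>.\<close>
      show "poly (poly ?L [:m:]) l = poly (poly ?R [:m:]) l"
        using \<open>?E\<close>[rule_format, of "- m" "l + m"]
        by (simp add: bracket_eval_def poly_sum poly_poly_at point_eval_def add.commute[of m l])
    qed
  qed
  have gens: "(\<forall>a b x y. bracket_eval f a b x y = (\<Sum>k<n. point_eval a x (g k) * point_eval b y (h k))) \<longleftrightarrow>
     (\<forall>i j x y. gen_eval2 i x j y (\<Sum>k<n. g k \<otimes> h k) = (y - x) * gen_eval (i + j) (x + y) f)"
    (is "?A \<longleftrightarrow> ?B") for n :: nat and g h
  proof
    assume ?A
    then show ?B
      by (simp add: functional_sum[OF functional_gen_eval2] tensor_eval_pure functional_point_eval
          flip: bracket_eval_generators)
  next
    assume ?B
    then have gg: "bracket_eval f (Lg i) (Lg j) x y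
        = (\<Sum>k<n. gen_eval i x (g k) * gen_eval j y (h k))" for i j x y
      by (simp add: functional_sum[OF functional_gen_eval2] tensor_eval_pure functional_point_eval
          bracket_eval_generators)
    \<comment> \<open>The identity is extended in the second argument first, with a generator on the
      left, and then in the first argument.\<close>
    have "bracket_eval f (Lg i) b x y = (\<Sum>k<n. gen_eval i x (g k) * point_eval b y (h k))" for i b x y
      by (induction b rule: generators_induct)
        (simp_all add: bracket_eval_right point_eval_arg gg sum.distrib sum_distrib_left algebra_simps)
    then have "bracket_eval f a b x y = (\<Sum>k<n. point_eval a x (g k) * point_eval b y (h k))" for a b x y
      by (induction a rule: generators_induct)
        (simp_all add: bracket_eval_left point_eval_arg sum.distrib sum_distrib_left algebra_simps)
    then show ?A by blast
  qed
  have "is_coproduct br W f t \<longleftrightarrow> (\<exists>(n::nat) g h. (\<forall>k<n. g k \<in> W \<and> h k \<in> W) \<and>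
      t = (\<Sum>k<n. g k \<otimes> h k) \<and>
      (\<forall>i j x y. gen_eval2 i x j y (\<Sum>k<n. g k \<otimes> h k) = (y - x) * gen_eval (i + j) (x + y) f))"
    unfolding is_coproduct_def eq gens[symmetric] by blast
  then show ?thesis
    unfolding has_coproduct_def tensor_sub_sum_iff[OF pd_subspace_imp_cvec_subspace[OF assms]]
    by (auto simp only:)
qed

text \<open>The values prescribed by \<open>f\<close> determine the tensor, because products of
  evaluations separate tensors.\<close>

lemma has_coproduct_unique: "has_coproduct W f t \<Longrightarrow> has_coproduct W f t' \<Longrightarrow> t = t'"
  by (rule gen_eval2_eqI) (simp add: has_coproduct_def)

lemma has_coproduct_mono: "W \<subseteq> W' \<Longrightarrow> has_coproduct W f t \<Longrightarrow> has_coproduct W' f t"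
  using tensor_sub_mono[of W W' W W'] by (auto simp: has_coproduct_def)

lemma good_coproduct_eq:
  assumes "pd.subspace W" "has_coproduct W f t"
  shows "good_coproduct br W f = t"
  unfolding good_coproduct_def is_coproduct_iff[OF assms(1)]
  using assms(2) has_coproduct_unique by blast

lemma good_submodule_iff:
  "good_submodule br W \<longleftrightarrow> pd.subspace W \<and> (\<forall>f\<in>W. \<exists>t. has_coproduct W f t)"
  unfolding good_submodule_def using is_coproduct_iff by blast

lemma has_coproduct_good_coproduct:
  assumes "good_submodule br W" "f \<in> W"
  shows "has_coproduct W f (good_coproduct br W f)"
  using assms good_coproduct_eq unfolding good_submodule_iff by metis

lemma has_coproduct_zero: "has_coproduct W 0 0"
  by (simp add: has_coproduct_def functional_zero[OF functional_gen_eval2]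
      functional_zero[OF functional_point_eval] cvec.subspace_0[OF subspace_tensor_sub])

lemma has_coproduct_add:
  "has_coproduct W f s \<Longrightarrow> has_coproduct W g t \<Longrightarrow> has_coproduct W (f + g) (s + t)"
  by (simp add: has_coproduct_def functional_add[OF functional_gen_eval2]
      functional_add[OF functional_point_eval] cvec.subspace_add[OF subspace_tensor_sub] algebra_simps)

lemma has_coproduct_pscale:
  "pd.subspace W \<Longrightarrow> has_coproduct W f t \<Longrightarrow> has_coproduct W (p \<cdot>\<^sub>\<partial> f) (p \<cdot>\<^sub>\<partial> t)"
  by (simp add: has_coproduct_def tensor_eval_pscale point_eval_pscale tensor_sub_pscale)

lemma good_submodule_spanI:
  assumes "\<And>f. f \<in> S \<Longrightarrow> \<exists>t. has_coproduct (pd.span S) f t"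
  shows "good_submodule br (pd.span S)"
  unfolding good_submodule_iff
proof (intro conjI ballI)
  fix f assume "f \<in> pd.span S"
  then show "\<exists>t. has_coproduct (pd.span S) f t"
  proof (induction rule: pd.span_induct)
    case base
    show ?case
      using has_coproduct_zero has_coproduct_add has_coproduct_pscale[OF pd.subspace_span]
      by (intro pd.subspaceI) blast+
  qed (use assms in blast)
qed simp

text \<open>A coproduct with factors in one member is still a coproduct in the sum. This is why the
  sum of all good submodules is good.\<close>

lemma good_submodule_Union:
  assumes "\<And>W. W \<in> \<W> \<Longrightarrow> good_submodule br W"
  shows "good_submodule br (pd.span (\<Union>\<W>))"
proof (rule good_submodule_spanI)
  fix f assume "f \<in> \<Union>\<W>"
  then obtain W where W: "W \<in> \<W>" "f \<in> W" by (rule UnionE)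
  have "W \<subseteq> pd.span (\<Union>\<W>)"
    using Union_upper[OF W(1)] pd.span_superset by (rule subset_trans)
  then have "has_coproduct (pd.span (\<Union>\<W>)) f (good_coproduct br W f)"
    using has_coproduct_good_coproduct[OF assms[OF W(1)] W(2)] by (rule has_coproduct_mono)
  then show "\<exists>t. has_coproduct (pd.span (\<Union>\<W>)) f t" by (rule exI)
qed

lemma good_submodule_largest_good: "good_submodule br (largest_good br)"
  unfolding largest_good_def by (rule good_submodule_Union) simp

lemma good_submodule_subset_largest_good: "good_submodule br W \<Longrightarrow> W \<subseteq> largest_good br"
  unfolding largest_good_def by (intro subsetI pd.span_base) blast

text \<open>By uniqueness the coproducts of \<open>C\<close> and \<open>W\<close> agree on
  \<open>W\<close>, and the latter has its factors in \<open>W\<close>.\<close>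

lemma good_imp_diff_lie_subcoalgebra:
  assumes "good_submodule br C" "good_submodule br W" "W \<subseteq> C"
  shows "diff_lie_subcoalgebra C (good_coproduct br C) W"
  unfolding diff_lie_subcoalgebra_def
proof (intro conjI image_subsetI)
  fix f assume "f \<in> W"
  then have W: "has_coproduct W f (good_coproduct br W f)"
    by (rule has_coproduct_good_coproduct[OF assms(2)])
  then have "good_coproduct br C f = good_coproduct br W f"
    using assms(1) good_coproduct_eq[OF _ has_coproduct_mono[OF assms(3)]]
    by (simp add: good_submodule_iff)
  with W show "good_coproduct br C f \<in> tensor_sub W W"
    by (simp add: has_coproduct_def)
qed (use assms in \<open>simp_all add: good_submodule_iff\<close>)

text \<open>Linearity of \<delta> follows from uniqueness of coproducts; skew-symmetry and co-Jacobi
  are compared through evaluations at generators.\<close>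

lemma good_imp_diff_lie_coalgebra:
  assumes "good_submodule br W"
  shows "diff_lie_coalgebra W (good_coproduct br W)"
  unfolding diff_lie_coalgebra_def Let_def
proof (intro conjI ballI allI image_subsetI)
  let ?\<delta> = "good_coproduct br W"
  have cop: "has_coproduct W f (?\<delta> f)" if "f \<in> W" for f
    using assms that by (rule has_coproduct_good_coproduct)
  have eval: "gen_eval2 i x j y (?\<delta> f) = (y - x) * gen_eval (i + j) (x + y) f"
    if "f \<in> W" for f i j x y
    using cop[OF that] by (simp add: has_coproduct_def)
  \<comment> \<open>Pulling a double evaluation back along \<delta> gives a single evaluation times
    a constant such as \<open>z - y\<close>. A factor 1 on the other side keeps one uniform shape
    for both.\<close>
  have scaled: "functional (\<lambda>g. c * gen_eval i x g)" for c i x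
    by (intro functional_mult functional_point_eval)
  have eval_scaled: "tensor_eval (\<lambda>g. c * gen_eval i x g) (\<lambda>g. d * gen_eval j y g) t
      = c * d * gen_eval2 i x j y t" for c d i j x y t
    by (rule functional_tensor_eq)
      (simp_all add: functional_tensor_eval scaled tensor_eval_pure functional_point_eval
        functional_mult)
  show W: "pd.subspace W"
    using assms by (simp add: good_submodule_iff)
  fix f assume f: "f \<in> W"
  then show in_W: "?\<delta> f \<in> tensor_sub W W"
    using cop by (simp add: has_coproduct_def)
  show "?\<delta> (f + g) = ?\<delta> f + ?\<delta> g" if "g \<in> W" for g
    by (intro good_coproduct_eq W has_coproduct_add cop f that)
  show "?\<delta> (p \<cdot>\<^sub>\<partial> f) = p \<cdot>\<^sub>\<partial> ?\<delta> f" for p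
    by (intro good_coproduct_eq W has_coproduct_pscale cop f)
  show "tensor_swap (?\<delta> f) = - ?\<delta> f"
    by (rule gen_eval2_eqI)
      (simp add: tensor_eval_swap functional_point_eval functional_neg[OF functional_gen_eval2]
        eval[OF f] algebra_simps)
  let ?t = "tensor_assoc (tensor_map_on W W id ?\<delta> (?\<delta> f))"
  \<comment> \<open>The inner \<delta> on the second factor produces \<open>z - y\<close> and merges
    two points into \<open>y + z\<close>; the outer \<delta> then produces
    \<open>y + z - x\<close>.\<close>
  have ev_t: "tensor_eval (gen_eval2 i x j y) (gen_eval k z) ?t
      = (z - y) * (y + z - x) * gen_eval (i + j + k) (x + y + z) f" for i x j y k z
  proof -
    have "tensor_eval (gen_eval2 i x j y) (gen_eval k z) ?t
        = tensor_eval (\<lambda>g. 1 * gen_eval i x g) (\<lambda>g. (z - y) * gen_eval (j + k) (y + z) g) (?\<delta> f)"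
      unfolding tensor_eval_assoc[OF functional_point_eval functional_point_eval functional_point_eval]
      by (intro tensor_eval_map_on functional_point_eval functional_gen_eval2 scaled in_W)
        (simp_all add: eval)
    then show ?thesis
      by (simp only: eval_scaled eval[OF f]) (simp add: add.assoc)
  qed
  show "?t - tensor_map_on UNIV UNIV tensor_swap id ?t = tensor_map_on W W ?\<delta> id (?\<delta> f)"
  proof (rule gen_eval3_eqI)
    fix i x j y k z
    let ?e = "\<lambda>i x j y. tensor_eval (gen_eval2 i x j y) (gen_eval k z)"
    have fe: "functional (?e i x j y)" for i x j y
      by (intro functional_tensor_eval functional_point_eval)
    have swap: "?e i x j y (tensor_map_on UNIV UNIV tensor_swap id ?t) = ?e j y i x ?t"
      by (rule tensor_eval_map_on)
        (simp_all add: functional_gen_eval2 functional_point_eval tensor_sub_UNIV tensor_eval_swap)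
    have right: "?e i x j y (tensor_map_on W W ?\<delta> id (?\<delta> f))
        = tensor_eval (\<lambda>g. (y - x) * gen_eval (i + j) (x + y) g) (\<lambda>g. 1 * gen_eval k z g) (?\<delta> f)"
      by (intro tensor_eval_map_on functional_point_eval functional_gen_eval2 scaled in_W)
        (simp_all add: eval)
    show "?e i x j y (?t - tensor_map_on UNIV UNIV tensor_swap id ?t)
        = ?e i x j y (tensor_map_on W W ?\<delta> id (?\<delta> f))"
      \<comment> \<open>Once the order in \<open>i + j\<close> and \<open>x + y\<close> is
        normalized, all three terms carry the same value of \<open>f\<close>, and a polynomial
        identity in \<open>x\<close>, \<open>y\<close>, \<open>z\<close> remains.\<close>
      unfolding functional_diff[OF fe] swap right ev_t eval_scaled eval[OF f]
      by (simp add: add.commute[of j i] add.commute[of y x]) (simp add: algebra_simps)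
  qed
qed

text \<open>At \<open>x = 0\<close> (that is \<open>\<mu> = 0\<close>) the first tensor factors of the coproduct become vectors in a
  finite-dimensional complex space, so finitely many of them satisfy a scalar linear relation.\<close>

lemma good_imp_linearly_recursive:
  assumes "good_submodule br W" "f \<in> W"
  shows "linearly_recursive Lg f"
proof -
  define t where "t = good_coproduct br W f"
  have t: "has_coproduct W f t"
    unfolding t_def using assms by (rule has_coproduct_good_coproduct)
  then have "t \<in> tensor_sub W W"
    by (simp add: has_coproduct_def)
  moreover have "cvec.subspace W"
    using assms(1) good_submodule_iff by (intro pd_subspace_imp_cvec_subspace) simp
  ultimately obtain n :: nat and g h where gh: "t = (\<Sum>k<n. g k \<otimes> h k)"
    by (auto simp: tensor_sub_sum_iff)
  have eq: "(\<Sum>k<n. gen_eval i 0 (g k) * gen_eval j y (h k)) = y * gen_eval (i + j) y f" for i j y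
    using t by (simp add: has_coproduct_def gh functional_sum[OF functional_gen_eval2]
        tensor_eval_pure functional_point_eval)
  \<comment> \<open>These are \<open>n + 1\<close> vectors in complex \<open>n\<close>-space. Their
    relation involves only the first tensor factors, so one \<beta> serves every \<open>m\<close>
    and the recurrence holds from index 0 on.\<close>
  have "finite {..n}" "n < card {..n}" by simp_all
  from ex_nontrivial_relation[OF this, of "\<lambda>s k. gen_eval s 0 (g k)"]
  obtain \<beta> where "\<exists>s\<in>{..n}. \<beta> s \<noteq> 0" "\<forall>k<n. (\<Sum>s\<le>n. \<beta> s * gen_eval s 0 (g k)) = 0"
    by (elim exE conjE)
  then have \<beta>: "\<exists>s\<le>n. \<beta> s \<noteq> 0" "\<And>k. k < n \<Longrightarrow> (\<Sum>s\<le>n. \<beta> s * gen_eval s 0 (g k)) = 0"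
    by auto
  have "(\<Sum>s\<le>n. smult (\<beta> s) (dual_apply f (Lg (m + s)))) = 0" for m
  proof -
    let ?P = "\<Sum>s\<le>n. smult (\<beta> s) (dual_apply f (Lg (m + s)))"
    \<comment> \<open>At \<open>x = 0\<close> the coproduct yields \<open>f\<close> only with the
      factor \<open>y\<close>, so the recurrence is first proved multiplied by the variable, which
      is then cancelled.\<close>
    have "poly ([:0, 1:] * ?P) y = 0" for y
    proof -
      have "poly ([:0, 1:] * ?P) y = (\<Sum>s\<le>n. \<beta> s * (y * gen_eval (s + m) y f))"
        by (simp add: poly_sum point_eval_def sum_distrib_left algebra_simps)
      also have "\<dots> = (\<Sum>s\<le>n. \<Sum>k<n. (\<beta> s * gen_eval s 0 (g k)) * gen_eval m y (h k))"
        by (simp add: eq[symmetric] sum_distrib_left mult.assoc)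
      also have "\<dots> = (\<Sum>k<n. (\<Sum>s\<le>n. \<beta> s * gen_eval s 0 (g k)) * gen_eval m y (h k))"
        by (subst sum.swap) (simp add: sum_distrib_right)
      also have "\<dots> = 0" by (simp add: \<beta>(2))
      finally show ?thesis .
    qed
    then have "[:0, 1:] * ?P = 0"
      by (intro poly_all_0_iff_0[THEN iffD1] allI)
    then show ?thesis by (simp only: mult_eq_0_iff) simp
  qed
  with \<beta>(1) show ?thesis
    unfolding linearly_recursive_def by blast
qed

section \<open>Coproducts of the basis functionals\<close>

lemma gen_eval_exp_poly_dual: "gen_eval i x (exp_poly_dual Lg a m) = a ^ i * of_nat i ^ m"
  by (simp add: point_eval_def)

lemma gen_eval_dual_gen: "gen_eval i x (dual_gen Lg j) = (if i = j then 1 else 0)"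
  by (simp add: point_eval_def)

lemma gen_eval2_deriv_diff:
  "gen_eval2 i x j y (\<partial> g \<otimes> h - g \<otimes> \<partial> h) = (y - x) * (gen_eval i x g * gen_eval j y h)"
  by (simp add: functional_diff[OF functional_gen_eval2] tensor_eval_pure functional_point_eval
      point_eval_deriv algebra_simps)

lemma deriv_diff_in_tensor_sub:
  assumes "pd.subspace W" "g \<in> W" "h \<in> W"
  shows "\<partial> g \<otimes> h - g \<otimes> \<partial> h \<in> tensor_sub W W"
  by (intro cvec.subspace_diff[OF subspace_tensor_sub] tensor_sub_pure assms
      pd_subspace_deriv[OF assms(1)])

text \<open>The powers of \<open>a\<close> multiply and the binomial theorem splits the
  \<open>m\<close>-th power of \<open>i + j\<close>; the combination \<partial> \<otimes> 1 - 1
  \<otimes> \<partial> supplies the factor \<open>y - x\<close>.\<close>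

lemma has_coproduct_exp_poly_dual:
  assumes "pd.subspace W" "\<And>j. j \<le> m \<Longrightarrow> exp_poly_dual Lg a j \<in> W"
  shows "has_coproduct W (exp_poly_dual Lg a m)
    (\<Sum>j\<le>m. of_nat (m choose j) \<cdot>\<^sub>\<complex>
      (\<partial> (exp_poly_dual Lg a j) \<otimes> exp_poly_dual Lg a (m - j) -
       exp_poly_dual Lg a j \<otimes> \<partial> (exp_poly_dual Lg a (m - j))))"
  unfolding has_coproduct_def
proof (intro conjI allI)
  fix i j x y
  have "(y - x) * (\<Sum>k\<le>m. of_nat (m choose k) * (a ^ i * of_nat i ^ k * (a ^ j * of_nat j ^ (m - k))))
      = (y - x) * (a ^ (i + j) * (\<Sum>k\<le>m. of_nat (m choose k) * of_nat i ^ k * of_nat j ^ (m - k)))"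
    by (simp add: sum_distrib_left power_add algebra_simps)
  also have "\<dots> = (y - x) * (a ^ (i + j) * of_nat (i + j) ^ m)"
    by (simp add: binomial_ring)
  finally show "gen_eval2 i x j y (\<Sum>j\<le>m. of_nat (m choose j) \<cdot>\<^sub>\<complex>
      (\<partial> (exp_poly_dual Lg a j) \<otimes> exp_poly_dual Lg a (m - j) -
       exp_poly_dual Lg a j \<otimes> \<partial> (exp_poly_dual Lg a (m - j))))
      = (y - x) * gen_eval (i + j) (x + y) (exp_poly_dual Lg a m)"
    unfolding functional_sum[OF functional_gen_eval2] functional_cscale[OF functional_gen_eval2]
      gen_eval2_deriv_diff gen_eval_exp_poly_dual
    by (simp add: sum_distrib_left mult.left_commute)
qed (intro cvec.subspace_sum cvec.subspace_scale subspace_tensor_sub deriv_diff_in_tensor_sub assms; simp)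

text \<open>The indicator of \<open>i + j = m\<close> is the sum over \<open>k \<le> m\<close> of
  the products of the indicators of \<open>i = k\<close> and \<open>j = m - k\<close>.\<close>

lemma has_coproduct_dual_gen:
  assumes "pd.subspace W" "\<And>j. j \<le> m \<Longrightarrow> dual_gen Lg j \<in> W"
  shows "has_coproduct W (dual_gen Lg m)
    (\<Sum>j\<le>m. \<partial> (dual_gen Lg j) \<otimes> dual_gen Lg (m - j) - dual_gen Lg j \<otimes> \<partial> (dual_gen Lg (m - j)))"
  unfolding has_coproduct_def
proof (intro conjI allI)
  fix i j x y
  have "(\<Sum>k\<le>m. (if i = k then 1 else 0) * (if j = m - k then 1 else 0 :: complex))
      = (\<Sum>k\<le>m. if i = k then if j = m - i then 1 else 0 else 0)"
    by (intro sum.cong) auto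
  also have "\<dots> = (if i + j = m then 1 else 0)"
    by auto
  finally show "gen_eval2 i x j y (\<Sum>j\<le>m. \<partial> (dual_gen Lg j) \<otimes> dual_gen Lg (m - j) -
        dual_gen Lg j \<otimes> \<partial> (dual_gen Lg (m - j)))
      = (y - x) * gen_eval (i + j) (x + y) (dual_gen Lg m)"
    unfolding functional_sum[OF functional_gen_eval2] gen_eval2_deriv_diff gen_eval_dual_gen
    by (simp add: sum_distrib_left[symmetric])
qed (intro cvec.subspace_sum subspace_tensor_sub deriv_diff_in_tensor_sub assms; simp)

text \<open>The coproduct keeps \<open>a\<close> and involves no exponent above \<open>m\<close>, so
  these finitely many generators already span a good submodule. Such spans are the source of
  finite-rank subcoalgebras.\<close>

lemma good_submodule_exp_poly_dual: "good_submodule br (pd.span (exp_poly_dual Lg a ` {..m}))"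
proof (rule good_submodule_spanI)
  fix g assume "g \<in> exp_poly_dual Lg a ` {..m}"
  then obtain j where j: "j \<le> m" "g = exp_poly_dual Lg a j" by auto
  show "\<exists>t. has_coproduct (pd.span (exp_poly_dual Lg a ` {..m})) g t"
    unfolding j(2)
    by (rule exI, rule has_coproduct_exp_poly_dual) (use j in \<open>auto intro: pd.span_base\<close>)
qed

lemma good_submodule_dual_gen: "good_submodule br (pd.span (dual_gen Lg ` {..m}))"
proof (rule good_submodule_spanI)
  fix g assume "g \<in> dual_gen Lg ` {..m}"
  then obtain j where j: "j \<le> m" "g = dual_gen Lg j" by auto
  show "\<exists>t. has_coproduct (pd.span (dual_gen Lg ` {..m})) g t"
    unfolding j(2)
    by (rule exI, rule has_coproduct_dual_gen) (use j in \<open>auto intro: pd.span_base\<close>)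
qed

lemma good_submodule_exp_poly_duals:
  "good_submodule br (pd.span {exp_poly_dual Lg a m |a m. a \<noteq> 0})"
proof (rule good_submodule_spanI)
  fix g assume "g \<in> {exp_poly_dual Lg a m |a m. a \<noteq> 0}"
  then obtain a m where g: "a \<noteq> 0" "g = exp_poly_dual Lg a m" by auto
  show "\<exists>t. has_coproduct (pd.span {exp_poly_dual Lg a m |a m. a \<noteq> 0}) g t"
    unfolding g(2)
    by (rule exI, rule has_coproduct_exp_poly_dual) (use g in \<open>auto intro: pd.span_base\<close>)
qed

end

section \<open>Linear recurrences\<close>

text \<open>This is the value at \<open>i\<close> of q(E) applied to \<open>G\<close>, where E is
  the shift.\<close>

definition recurrence :: "complex poly \<Rightarrow> (nat \<Rightarrow> complex poly) \<Rightarrow> nat \<Rightarrow> complex poly"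
  where "recurrence q G i = (\<Sum>s\<le>degree q. smult (coeff q s) (G (i + s)))"

lemma smult_sum_right: "smult c (sum f A) = (\<Sum>i\<in>A. smult c (f i))"
  by (induction A rule: infinite_finite_induct) (simp_all add: smult_add_right)

lemma recurrence_bound:
  assumes "degree q \<le> n"
  shows "recurrence q G i = (\<Sum>s\<le>n. smult (coeff q s) (G (i + s)))"
  unfolding recurrence_def using assms
  by (intro sum.mono_neutral_left) (auto simp: coeff_eq_0)

lemma recurrence_add_left: "recurrence (p + q) G i = recurrence p G i + recurrence q G i"
  by (simp add: recurrence_bound[of _ "max (degree p) (degree q)"] degree_add_le
      smult_add_left sum.distrib)

lemma recurrence_smult_left: "recurrence (smult c q) G i = smult c (recurrence q G i)"
  by (simp add: recurrence_bound[of "smult c q" "degree q"] recurrence_def smult_sum_right)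

lemma recurrence_pCons_0: "recurrence (pCons 0 q) G i = recurrence q G (Suc i)"
  unfolding recurrence_bound[OF degree_pCons_le, of 0 q]
  by (subst sum.atMost_Suc_shift) (simp add: recurrence_def)

text \<open>Polynomials in the shift E commute, so a factor E - a of the recurrence can be moved
  onto the sequence.\<close>

lemma recurrence_linear_factor:
  "recurrence ([:- a, 1:] * q) G i = recurrence q (\<lambda>i. G (Suc i) - smult a (G i)) i"
proof -
  have "[:- a, 1:] * q = smult (- a) q + pCons 0 q"
    by simp
  then have "recurrence ([:- a, 1:] * q) G i = - smult a (recurrence q G i) + recurrence q G (Suc i)"
    by (simp only: recurrence_add_left recurrence_smult_left recurrence_pCons_0) simp
  also have "\<dots> = recurrence q (\<lambda>i. G (Suc i) - smult a (G i)) i"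
    by (simp add: recurrence_def smult_sum_right smult_diff_right sum_subtractf mult.commute)
  finally show ?thesis .
qed

section \<open>The operators E - a on functionals: image and kernel\<close>

context free_generators
begin

definition shift_minus :: "complex \<Rightarrow> 'l cdual \<Rightarrow> 'l cdual"
  where "shift_minus a f =
    seq_dual (\<lambda>i. dual_apply f (Lg (Suc i)) - smult a (dual_apply f (Lg i)))"

lemma dual_apply_shift_minus [simp]:
  "dual_apply (shift_minus a f) (Lg i) = dual_apply f (Lg (Suc i)) - smult a (dual_apply f (Lg i))"
  by (simp add: shift_minus_def)

lemma shift_minus_add: "shift_minus a (f + g) = shift_minus a f + shift_minus a g"
  by (rule dual_eq_generatorsI) (simp add: dual_apply_add_left smult_add_right)

lemma shift_minus_diff: "shift_minus a (f - g) = shift_minus a f - shift_minus a g"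
  by (rule dual_eq_generatorsI) (simp add: dual_apply_diff_left smult_diff_right)

lemma shift_minus_pscale: "shift_minus a (p \<cdot>\<^sub>\<partial> f) = p \<cdot>\<^sub>\<partial> shift_minus a f"
  by (rule dual_eq_generatorsI) (simp add: dual_apply_pscale_left algebra_simps)

lemma subspace_shift_minus_image:
  assumes "pd.subspace S"
  shows "pd.subspace (shift_minus a ` S)"
proof (rule pd.subspaceI)
  have "shift_minus a 0 = 0"
    by (rule dual_eq_generatorsI) (simp add: dual_apply_zero_left)
  then show "0 \<in> shift_minus a ` S"
    using pd.subspace_0[OF assms] by force
next
  fix x y assume "x \<in> shift_minus a ` S" "y \<in> shift_minus a ` S"
  then obtain f g where "f \<in> S" "g \<in> S" "x = shift_minus a f" "y = shift_minus a g" by auto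
  then show "x + y \<in> shift_minus a ` S"
    by (auto simp flip: shift_minus_add intro: pd.subspace_add[OF assms])
next
  fix p x assume "x \<in> shift_minus a ` S"
  then show "p \<cdot>\<^sub>\<partial> x \<in> shift_minus a ` S"
    by (auto simp flip: shift_minus_pscale intro: pd.subspace_scale[OF assms])
qed

text \<open>Expanding the \<open>m\<close>-th power of \<open>i + 1\<close> shows that the shift is
  triangular in \<open>m\<close> with diagonal entry \<open>b\<close>.\<close>

lemma shift_minus_exp_poly_dual:
  "shift_minus a (exp_poly_dual Lg b m) = (b - a) \<cdot>\<^sub>\<complex> exp_poly_dual Lg b m +
    b \<cdot>\<^sub>\<complex> (\<Sum>k<m. of_nat (m choose k) \<cdot>\<^sub>\<complex> exp_poly_dual Lg b k)"
proof (rule dual_eq_generatorsI)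
  fix i
  have c: "(\<Sum>k<m. [:g k:]) = [:\<Sum>k<m. g k:]" for g :: "nat \<Rightarrow> complex"
    by (induction m) simp_all
  have "(of_nat i + 1 :: complex) ^ m = (\<Sum>k\<le>m. of_nat (m choose k) * of_nat i ^ k * 1 ^ (m - k))"
    by (rule binomial_ring)
  also have "\<dots> = of_nat i ^ m + (\<Sum>k<m. of_nat (m choose k) * of_nat i ^ k)"
    by (simp add: lessThan_Suc_atMost[symmetric])
  finally have e: "(1 + of_nat i :: complex) ^ m
      = of_nat i ^ m + (\<Sum>k<m. of_nat (m choose k) * of_nat i ^ k)"
    by (simp add: add.commute)
  show "dual_apply (shift_minus a (exp_poly_dual Lg b m)) (Lg i) =
    dual_apply ((b - a) \<cdot>\<^sub>\<complex> exp_poly_dual Lg b m +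
      b \<cdot>\<^sub>\<complex> (\<Sum>k<m. of_nat (m choose k) \<cdot>\<^sub>\<complex> exp_poly_dual Lg b k)) (Lg i)"
    by (simp add: dual_apply_add_left dual_apply_cscale_left dual_apply_sum_left c e)
      (simp add: sum_distrib_left algebra_simps)
qed

lemma shift_minus_dual_gen_0: "shift_minus a (dual_gen Lg 0) = - (a \<cdot>\<^sub>\<complex> dual_gen Lg 0)"
  by (rule dual_eq_generatorsI)
    (simp add: dual_apply_cscale_left cscale_def[of a] pd.scale_minus_left[symmetric] dual_apply_pscale_left)

lemma shift_minus_dual_gen_Suc:
  "shift_minus a (dual_gen Lg (Suc j)) = dual_gen Lg j - a \<cdot>\<^sub>\<complex> dual_gen Lg (Suc j)"
  by (rule dual_eq_generatorsI) (simp add: dual_apply_cscale_left dual_apply_diff_left)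

text \<open>This is V + U.\<close>

definition exp_poly_span :: "'l cdual set"
  where "exp_poly_span = pd.span (range (dual_gen Lg) \<union> {exp_poly_dual Lg a m |a m. a \<noteq> 0})"

lemma subspace_exp_poly_span: "pd.subspace exp_poly_span"
  by (simp add: exp_poly_span_def)

lemma dual_gen_in_exp_poly_span: "dual_gen Lg j \<in> exp_poly_span"
  unfolding exp_poly_span_def by (rule pd.span_base) simp

lemma exp_poly_dual_in_exp_poly_span: "a \<noteq> 0 \<Longrightarrow> exp_poly_dual Lg a m \<in> exp_poly_span"
  unfolding exp_poly_span_def by (rule pd.span_base) auto

text \<open>Surjectivity of E - a on V + U, checked on the generators by solving the triangular
  formulas for them.\<close>

lemma exp_poly_span_subset_shift_minus_image: "exp_poly_span \<subseteq> shift_minus a ` exp_poly_span"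
proof -
  let ?I = "shift_minus a ` exp_poly_span"
  have I: "pd.subspace ?I"
    by (intro subspace_shift_minus_image subspace_exp_poly_span)
  note cI = pd_subspace_imp_cvec_subspace[OF I]
  have T_dual: "shift_minus a (dual_gen Lg j) \<in> ?I" for j
    by (intro imageI dual_gen_in_exp_poly_span)
  have "dual_gen Lg j \<in> ?I" for j
  proof (cases "a = 0")
    case True
    then show ?thesis
      using T_dual[of "Suc j"] by (simp add: shift_minus_dual_gen_Suc)
  next
    \<comment> \<open>The formula for \<open>dual_gen Lg (Suc j)\<close> is solved for its multiple
      by the nonzero \<open>a\<close>; the remaining term has index \<open>j\<close>.\<close>
    case False
    have "a \<cdot>\<^sub>\<complex> dual_gen Lg j \<in> ?I"
    proof (induction j)
      case 0
      show ?case
        using pd.subspace_neg[OF I T_dual[of 0]] by (simp add: shift_minus_dual_gen_0)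
    next
      case (Suc j)
      then have "dual_gen Lg j \<in> ?I"
        using False I by (simp add: cscale_in_subspace_iff)
      from pd.subspace_diff[OF I this T_dual[of "Suc j"]] show ?case
        by (simp add: shift_minus_dual_gen_Suc)
    qed
    then show ?thesis
      using False I by (simp add: cscale_in_subspace_iff)
  qed
  moreover have "exp_poly_dual Lg b m \<in> ?I" if b: "b \<noteq> 0" for b m
  proof -
    have T: "shift_minus a (exp_poly_dual Lg b m) \<in> ?I" for m
      by (intro imageI exp_poly_dual_in_exp_poly_span b)
    show ?thesis
    proof (induction m rule: less_induct)
      case (less m)
      then have low: "(\<Sum>k<m. c k \<cdot>\<^sub>\<complex> exp_poly_dual Lg b k) \<in> ?I" for c
        by (intro cvec.subspace_sum[OF cI] cvec.subspace_scale[OF cI]) simp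
      show ?case
      proof (cases "b = a")
        case False
        have "shift_minus a (exp_poly_dual Lg b m) -
            b \<cdot>\<^sub>\<complex> (\<Sum>k<m. of_nat (m choose k) \<cdot>\<^sub>\<complex> exp_poly_dual Lg b k) \<in> ?I"
          by (intro cvec.subspace_diff[OF cI] T cvec.subspace_scale[OF cI] low)
        then have "(b - a) \<cdot>\<^sub>\<complex> exp_poly_dual Lg b m \<in> ?I"
          by (simp add: shift_minus_exp_poly_dual)
        then show ?thesis
          using False I by (simp add: cscale_in_subspace_iff)
      next
        \<comment> \<open>For \<open>b = a\<close> the diagonal term vanishes, so a preimage is
          sought one exponent higher, where \<open>exp_poly_dual Lg b m\<close> is the top term,
          with factor \<open>m + 1\<close>.\<close>
        case True
        have "b \<cdot>\<^sub>\<complex> (\<Sum>k<Suc m. of_nat (Suc m choose k) \<cdot>\<^sub>\<complex> exp_poly_dual Lg b k) \<in> ?I"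
          using T[of "Suc m"] True unfolding shift_minus_exp_poly_dual by simp
        then have "(\<Sum>k<Suc m. of_nat (Suc m choose k) \<cdot>\<^sub>\<complex> exp_poly_dual Lg b k) \<in> ?I"
          by (rule iffD1[OF cscale_in_subspace_iff[OF I b]])
        from cvec.subspace_diff[OF cI this low[of "\<lambda>k. of_nat (Suc m choose k)"]]
        have "of_nat (Suc m) \<cdot>\<^sub>\<complex> exp_poly_dual Lg b m \<in> ?I"
          by simp
        then show ?thesis
          using I cscale_in_subspace_iff[of ?I "of_nat (Suc m)"] of_nat_neq_0 by blast
      qed
    qed
  qed
  ultimately show ?thesis
    unfolding exp_poly_span_def using I by (intro pd.span_minimal) (auto simp: exp_poly_span_def)
qed

lemma shift_minus_kernel:
  assumes "shift_minus a f = 0"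
  shows "f \<in> exp_poly_span"
proof -
  have Suc: "dual_apply f (Lg (Suc i)) = smult a (dual_apply f (Lg i))" for i
    using dual_apply_shift_minus[of a f i] by (simp add: assms dual_apply_zero_left)
  have f: "dual_apply f (Lg i) = smult (a ^ i) (dual_apply f (Lg 0))" for i
    by (induction i) (simp_all add: Suc)
  \<comment> \<open>A polynomial in \<partial> acts on the dual with \<lambda> replaced by
    -\<lambda>, so the initial value enters with the opposite sign of its variable.\<close>
  define p where "p = pcompose (dual_apply f (Lg 0)) [:0, -1:]"
  have p: "pcompose p [:0, -1:] = dual_apply f (Lg 0)"
    by (simp add: p_def pcompose_assoc[symmetric] pcompose_pCons)
  show ?thesis
  proof (cases "a = 0")
    \<comment> \<open>With \<open>a = 0\<close> the geometric sequence is supported at index 0,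
      because \<open>0 ^ 0 = 1\<close>.\<close>
    case True
    then have "f = p \<cdot>\<^sub>\<partial> dual_gen Lg 0"
      by (intro dual_eq_generatorsI) (subst f, simp add: dual_apply_pscale_left p power_0_left)
    then show ?thesis
      using pd.subspace_scale[OF subspace_exp_poly_span dual_gen_in_exp_poly_span] by simp
  next
    case False
    have "f = p \<cdot>\<^sub>\<partial> exp_poly_dual Lg a 0"
      by (intro dual_eq_generatorsI) (subst f, simp add: dual_apply_pscale_left p)
    then show ?thesis
      using pd.subspace_scale[OF subspace_exp_poly_span exp_poly_dual_in_exp_poly_span[OF False]] by simp
  qed
qed

lemma recurrence_imp_exp_poly_span:
  assumes "q \<noteq> 0" "\<And>i. recurrence q (\<lambda>i. dual_apply f (Lg i)) i = 0"
  shows "f \<in> exp_poly_span"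
  using assms
proof (induction "degree q" arbitrary: q f)
  case 0
  then obtain c where "q = [:c:]" "c \<noteq> 0"
    by (metis degree_eq_zeroE pCons_0_0)
  with 0 have "f = 0"
    by (intro dual_eq_generatorsI) (simp add: recurrence_def dual_apply_zero_left)
  then show ?case
    by (simp add: pd.subspace_0 subspace_exp_poly_span)
next
  case (Suc n)
  then obtain a where "poly q a = 0"
    using fundamental_theorem_of_algebra[of q] constant_degree[of q] by auto
  then obtain q' where q: "q = [:- a, 1:] * q'"
    by (auto simp: poly_eq_0_iff_dvd)
  with Suc.prems(1) have q': "q' \<noteq> 0" by auto
  have "degree q = Suc (degree q')"
    unfolding q using q' by (subst degree_mult_eq) auto
  with Suc.hyps(2) have "n = degree q'" by simp
  moreover have "recurrence q' (\<lambda>i. dual_apply (shift_minus a f) (Lg i)) i = 0" for i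
    using Suc.prems(2)[of i] by (simp only: q recurrence_linear_factor dual_apply_shift_minus)
  ultimately have "shift_minus a f \<in> exp_poly_span"
    using Suc.hyps(1) q' by blast
  \<comment> \<open>Surjectivity corrects \<open>f\<close> by an element of V + U with the same
    image, leaving an element of the kernel of E - a.\<close>
  then obtain g where g: "g \<in> exp_poly_span" "shift_minus a f = shift_minus a g"
    using exp_poly_span_subset_shift_minus_image by blast
  then have "f - g \<in> exp_poly_span"
    by (intro shift_minus_kernel[of a]) (simp add: shift_minus_diff)
  from pd.subspace_add[OF subspace_exp_poly_span this g(1)] show ?case by simp
qed

lemma linearly_recursive_imp_exp_poly_span:
  assumes "linearly_recursive Lg f"
  shows "f \<in> exp_poly_span"
proof -
  obtain N r \<beta> s0 where \<beta>: "s0 \<le> r" "\<beta> s0 \<noteq> 0"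
    and rec: "\<And>m. m \<ge> N \<Longrightarrow> (\<Sum>s\<le>r. smult (\<beta> s) (dual_apply f (Lg (m + s)))) = 0"
    using assms unfolding linearly_recursive_def by blast
  \<comment> \<open>Shifting the exponents by \<open>N\<close> turns a relation valid from
    \<open>N\<close> on into one valid at every index.\<close>
  define q where "q = (\<Sum>s\<le>r. monom (\<beta> s) (N + s))"
  have "coeff q (N + s0) = (\<Sum>s\<le>r. if s = s0 then \<beta> s else 0)"
    by (simp add: q_def coeff_sum)
  then have "coeff q (N + s0) = \<beta> s0"
    using \<beta>(1) by simp
  then have "q \<noteq> 0"
    using \<beta>(2) by auto
  moreover have "recurrence q (\<lambda>i. dual_apply f (Lg i)) i = 0" for i
  proof -
    let ?G = "\<lambda>i. dual_apply f (Lg i)"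
    have monom: "recurrence (monom c n) ?G i = smult c (?G (i + n))" for c n
    proof -
      have "recurrence (monom c n) ?G i = (\<Sum>s\<le>n. smult (coeff (monom c n) s) (?G (i + s)))"
        by (rule recurrence_bound) (rule degree_monom_le)
      also have "\<dots> = (\<Sum>s\<le>n. if s = n then smult c (?G (i + n)) else 0)"
        by (intro sum.cong) auto
      finally show ?thesis by simp
    qed
    have "recurrence (\<Sum>s\<in>A. g s) ?G i = (\<Sum>s\<in>A. recurrence (g s) ?G i)" for A and g :: "nat \<Rightarrow> _"
      by (induction A rule: infinite_finite_induct)
        (simp_all add: recurrence_add_left recurrence_def[of 0])
    then have "recurrence q ?G i = (\<Sum>s\<le>r. smult (\<beta> s) (?G ((i + N) + s)))"
      by (simp add: q_def monom add.assoc)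
    also have "\<dots> = 0" by (rule rec) simp
    finally show ?thesis .
  qed
  ultimately show ?thesis by (rule recurrence_imp_exp_poly_span)
qed

end

section \<open>Independence of exponential polynomials\<close>

lemma poly_eq_0_if_vanishes_beyond:
  fixes p :: "complex poly"
  assumes "\<And>i. i \<ge> J \<Longrightarrow> poly p (of_nat i) = 0"
  shows "p = 0"
proof (rule ccontr)
  assume "p \<noteq> 0"
  then have "finite {z. poly p z = 0}" by (rule poly_roots_finite)
  moreover have "of_nat ` {J..} \<subseteq> {z. poly p z = 0}"
    using assms by auto
  ultimately have "finite (of_nat ` {J..} :: complex set)"
    by (rule rev_finite_subset)
  then have "finite {J..}"
    by (rule finite_imageD) (simp add: inj_on_def)
  then show False
    using infinite_Ici by blast
qed

text \<open>The degree raised by one, with 0 reserved for the zero polynomial: the measure also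
  drops when a nonzero constant becomes 0.\<close>

definition poly_size :: "'a::zero poly \<Rightarrow> nat"
  where "poly_size p = (if p = 0 then 0 else Suc (degree p))"

lemma lead_coeff_pcompose_shift: "lead_coeff (pcompose p [:1, 1:]) = lead_coeff (p :: complex poly)"
  by (subst lead_coeff_comp) simp_all

lemma poly_size_twisted_difference_le:
  "poly_size (smult b (pcompose p [:1, 1:]) - smult a p) \<le> poly_size (p :: complex poly)"
proof (cases "p = 0")
  case False
  have "degree (smult b (pcompose p [:1, 1:]) - smult a p) \<le> degree p"
    by (intro degree_diff_le) (auto intro: order_trans[OF degree_smult_le] simp: degree_pcompose)
  with False show ?thesis by (simp add: poly_size_def)
qed (simp add: poly_size_def)

text \<open>Translation preserves the leading coefficient, so the top terms cancel.\<close>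

lemma poly_size_difference_less:
  assumes "p \<noteq> (0 :: complex poly)"
  shows "poly_size (smult a (pcompose p [:1, 1:]) - smult a p) < poly_size p"
proof (rule ccontr)
  let ?q = "smult a (pcompose p [:1, 1:]) - smult a p"
  assume "\<not> ?thesis"
  then have "?q \<noteq> 0" "degree p \<le> degree ?q"
    using assms by (auto simp: poly_size_def split: if_splits)
  moreover from \<open>?q \<noteq> 0\<close> have "degree ?q \<le> degree p"
    using poly_size_twisted_difference_le[of a p a] assms by (simp add: poly_size_def)
  ultimately have "degree ?q = degree p" by simp
  then have "lead_coeff ?q = coeff ?q (degree p)" by (rule arg_cong)
  also have "\<dots> = 0"
    using lead_coeff_pcompose_shift[of p] by (simp add: degree_pcompose)
  finally show False
    using \<open>?q \<noteq> 0\<close> by (simp only: leading_coeff_0_iff)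
qed

text \<open>The coefficient in degree \<open>degree p\<close> is \<open>b - a\<close> times the
  leading coefficient of \<open>p\<close>.\<close>

lemma twisted_difference_eq_0:
  assumes "smult b (pcompose p [:1, 1:]) - smult a p = 0" "a \<noteq> b"
  shows "p = (0 :: complex poly)"
proof -
  have "coeff (smult b (pcompose p [:1, 1:]) - smult a p) (degree p) = (b - a) * lead_coeff p"
    using lead_coeff_pcompose_shift[of p] by (simp add: degree_pcompose algebra_simps)
  with assms show ?thesis by simp
qed

text \<open>The operator \<open>E - a\<close>, with \<open>E\<close> the shift, lowers the degree of the \<open>a\<close>-component and is
  injective on the others.\<close>

lemma exp_poly_sum_eq_0:
  fixes P :: "complex \<Rightarrow> complex poly"
  assumes "finite A" "0 \<notin> A"
    and "\<And>i. i \<ge> J \<Longrightarrow> (\<Sum>a\<in>A. a ^ i * poly (P a) (of_nat i)) = 0"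
    and "b \<in> A"
  shows "P b = 0"
  using assms(3,4)
proof (induction "\<Sum>a\<in>A. poly_size (P a)" arbitrary: P b rule: less_induct)
  case less
  show ?case
  proof (rule ccontr)
    assume nz: "P b \<noteq> 0"
    \<comment> \<open>Applying E - b to the sequence with terms
      \<open>a ^ i * poly (P a) (of_nat i)\<close> replaces \<open>P a\<close> by
      \<open>Q a\<close>.\<close>
    define Q where "Q a = smult a (pcompose (P a) [:1, 1:]) - smult b (P a)" for a
    have "(\<Sum>a\<in>A. poly_size (Q a)) < (\<Sum>a\<in>A. poly_size (P a))"
    proof (rule sum_strict_mono_ex1[OF assms(1)])
      show "\<forall>a\<in>A. poly_size (Q a) \<le> poly_size (P a)"
        by (simp add: Q_def poly_size_twisted_difference_le)
      show "\<exists>a\<in>A. poly_size (Q a) < poly_size (P a)"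
        using poly_size_difference_less[OF nz] less.prems(2) by (auto simp: Q_def)
    qed
    moreover have "(\<Sum>a\<in>A. a ^ i * poly (Q a) (of_nat i)) = 0" if "i \<ge> J" for i
    proof -
      have "(\<Sum>a\<in>A. a ^ i * poly (Q a) (of_nat i))
          = (\<Sum>a\<in>A. a ^ Suc i * poly (P a) (of_nat (Suc i))) -
            b * (\<Sum>a\<in>A. a ^ i * poly (P a) (of_nat i))"
        by (simp add: Q_def poly_pcompose sum_distrib_left sum_subtractf algebra_simps)
      then show ?thesis
        using less.prems(1)[of i] less.prems(1)[of "Suc i"] that by (simp del: power_Suc of_nat_Suc)
    qed
    ultimately have Q: "Q a = 0" if "a \<in> A" for a
      using less.hyps that by blast
    have P: "P a = 0" if "a \<in> A" "a \<noteq> b" for a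
      using twisted_difference_eq_0[of a "P a" b] Q[OF that(1)] that(2) by (simp add: Q_def)
    \<comment> \<open>Only the \<open>b\<close>-component is left, and its factor
      \<open>b ^ i\<close> is nonzero because \<open>0 \<notin> A\<close>.\<close>
    have "poly (P b) (of_nat i) = 0" if "i \<ge> J" for i
    proof -
      have "0 = (\<Sum>a\<in>A. a ^ i * poly (P a) (of_nat i))"
        using less.prems(1)[OF that] by simp
      also have "\<dots> = (\<Sum>a\<in>{b}. a ^ i * poly (P a) (of_nat i))"
        using assms(1) less.prems(2) P by (intro sum.mono_neutral_right) auto
      finally show ?thesis
        using assms(2) less.prems(2) by auto
    qed
    then have "P b = 0" by (rule poly_eq_0_if_vanishes_beyond)
    with nz show False by contradiction
  qed
qed

lemma exp_monomial_sum_eq_0: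
  fixes d :: "complex \<times> nat \<Rightarrow> complex"
  assumes "finite K" "\<And>a m. (a, m) \<in> K \<Longrightarrow> a \<noteq> 0"
    and "\<And>i. i \<ge> J \<Longrightarrow> (\<Sum>(a, m)\<in>K. d (a, m) * (a ^ i * of_nat i ^ m)) = 0"
    and "(b, n) \<in> K"
  shows "d (b, n) = 0"
proof -
  \<comment> \<open>Extending the coefficients by 0 lets the sum run over the full product of the
    two projections of \<open>K\<close>, so that the terms with a common \<open>a\<close> form one
    polynomial.\<close>
  define e where "e k = (if k \<in> K then d k else 0)" for k
  define P where "P a = (\<Sum>m\<in>snd ` K. monom (e (a, m)) m)" for a
  have "P b = 0"
  proof (rule exp_poly_sum_eq_0[of "fst ` K" J P])
    fix i assume i: "i \<ge> J"
    have "(\<Sum>a\<in>fst ` K. a ^ i * poly (P a) (of_nat i))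
        = (\<Sum>(a, m)\<in>fst ` K \<times> snd ` K. e (a, m) * (a ^ i * of_nat i ^ m))"
      by (simp add: P_def poly_sum poly_monom sum_distrib_left sum.cartesian_product algebra_simps)
    also have "\<dots> = (\<Sum>(a, m)\<in>K. d (a, m) * (a ^ i * of_nat i ^ m))"
      using assms(1) by (intro sum.mono_neutral_cong_right) (force simp: e_def)+
    finally show "(\<Sum>a\<in>fst ` K. a ^ i * poly (P a) (of_nat i)) = 0"
      using assms(3)[OF i] by simp
  qed (use assms in force)+
  then have "0 = coeff (P b) n" by simp
  also have "\<dots> = (\<Sum>m\<in>snd ` K. if m = n then e (b, n) else 0)"
    unfolding P_def coeff_sum by (intro sum.cong) auto
  also have "\<dots> = d (b, n)"
    using assms(1,4) by (force simp: e_def)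
  finally show ?thesis by simp
qed

text \<open>For an indexed family a repeated value is already a dependence, so this one condition
  yields both the injectivity and the independence in \<open>pd_basis\<close>.\<close>

definition family_independent :: "('i \<Rightarrow> 'a::pd_module) \<Rightarrow> 'i set \<Rightarrow> bool"
  where "family_independent b I \<longleftrightarrow>
    (\<forall>K c. finite K \<longrightarrow> K \<subseteq> I \<longrightarrow> (\<Sum>k\<in>K. c k \<cdot>\<^sub>\<partial> b k) = 0 \<longrightarrow> (\<forall>k\<in>K. c k = 0))"

lemma family_independentD:
  "family_independent b I \<Longrightarrow> finite K \<Longrightarrow> K \<subseteq> I \<Longrightarrow> (\<Sum>k\<in>K. c k \<cdot>\<^sub>\<partial> b k) = 0 \<Longrightarrow> k \<in> K \<Longrightarrow> c k = 0"
  unfolding family_independent_def by blast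

lemma family_independent_imp_pd_basis:
  assumes "family_independent b I"
  shows "pd_basis b I (pd.span (b ` I))"
  unfolding pd_basis_def
proof (intro conjI)
  show inj: "inj_on b I"
  proof (rule inj_onI, rule ccontr)
    fix k l assume *: "k \<in> I" "l \<in> I" "b k = b l" "k \<noteq> l"
    define c :: "'a \<Rightarrow> complex poly" where "c i = (if i = k then 1 else - 1)" for i
    have "(\<Sum>i\<in>{k, l}. c i \<cdot>\<^sub>\<partial> b i) = 0"
      using * by (simp add: c_def)
    then have "c k = 0"
      using assms * by (intro family_independentD[of b I "{k, l}" c k]) auto
    then show False by (simp add: c_def)
  qed
  show "pd.independent (b ` I)"
    unfolding pd.independent_explicit_module
  proof (intro allI impI)
    fix T u v assume *: "finite T" "T \<subseteq> b ` I" "(\<Sum>w\<in>T. u w \<cdot>\<^sub>\<partial> w) = 0" "v \<in> T"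
    define K where "K = I \<inter> b -` T"
    have bK: "b ` K = T" and injK: "inj_on b K"
      using *(2) inj by (auto simp: K_def inj_on_def)
    have "finite K"
      using *(1) injK bK finite_imageD by blast
    moreover have "(\<Sum>k\<in>K. u (b k) \<cdot>\<^sub>\<partial> b k) = 0"
      using *(3) by (simp add: bK[symmetric] sum.reindex[OF injK])
    ultimately have "u (b k) = 0" if "k \<in> K" for k
      using that by (intro family_independentD[OF assms, of K "\<lambda>k. u (b k)"]) (auto simp: K_def)
    then show "u v = 0"
      using *(4) bK by blast
  qed
qed simp

context free_generators
begin

text \<open>Evaluating a relation at generator \<open>i\<close> and point \<open>x\<close> gives an
  exponential polynomial in \<open>i\<close> plus a finitely supported term. For large
  \<open>i\<close> only the first part remains, so its coefficients vanish; the second part then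
  shows its coefficients one at a time.\<close>

lemma family_independent_exp_poly_dual_gen:
  "family_independent (case_sum (\<lambda>(a, m). exp_poly_dual Lg a m) (dual_gen Lg))
    (((- {0}) \<times> UNIV) <+> UNIV)"
  unfolding family_independent_def
proof (intro allI impI)
  let ?b = "case_sum (\<lambda>(a, m). exp_poly_dual Lg a m) (dual_gen Lg)"
  fix K and c :: "(complex \<times> nat) + nat \<Rightarrow> complex poly"
  assume K: "finite K" "K \<subseteq> ((- {0}) \<times> UNIV) <+> UNIV" "(\<Sum>k\<in>K. c k \<cdot>\<^sub>\<partial> ?b k) = 0"
  define K1 where "K1 = Inl -` K"
  define K2 where "K2 = Inr -` K"
  have "k \<in> K \<longleftrightarrow> k \<in> K1 <+> K2" for k
    by (cases k) (auto simp: K1_def K2_def)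
  then have K12: "K = K1 <+> K2" "finite K1" "finite K2"
    using finite_vimageI[OF K(1), of Inl] finite_vimageI[OF K(1), of Inr]
    by (simp_all add: set_eq_iff K1_def K2_def)
  have nz: "a \<noteq> 0" if "(a, m) \<in> K1" for a m
    using that K(2) by (auto simp: K1_def)
  have eval: "(\<Sum>(a, m)\<in>K1. poly (c (Inl (a, m))) (- x) * (a ^ i * of_nat i ^ m)) +
      (\<Sum>j\<in>K2. if i = j then poly (c (Inr j)) (- x) else 0) = 0" for x i
  proof -
    have "0 = gen_eval i x (\<Sum>k\<in>K. c k \<cdot>\<^sub>\<partial> ?b k)"
      unfolding K(3) by (simp add: functional_zero[OF functional_point_eval])
    also have "\<dots> = (\<Sum>k\<in>K. poly (c k) (- x) * gen_eval i x (?b k))"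
      by (simp add: functional_sum[OF functional_point_eval] point_eval_pscale)
    also have "\<dots> = (\<Sum>k\<in>K1. poly (c (Inl k)) (- x) * gen_eval i x (?b (Inl k))) +
        (\<Sum>j\<in>K2. poly (c (Inr j)) (- x) * gen_eval i x (?b (Inr j)))"
      by (simp add: K12 sum.Plus)
    also have "(\<Sum>k\<in>K1. poly (c (Inl k)) (- x) * gen_eval i x (?b (Inl k)))
        = (\<Sum>(a, m)\<in>K1. poly (c (Inl (a, m))) (- x) * (a ^ i * of_nat i ^ m))"
      by (intro sum.cong) (auto simp: point_eval_def)
    also have "(\<Sum>j\<in>K2. poly (c (Inr j)) (- x) * gen_eval i x (?b (Inr j)))
        = (\<Sum>j\<in>K2. if i = j then poly (c (Inr j)) (- x) else 0)"
      by (intro sum.cong) (auto simp: point_eval_def)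
    finally show ?thesis by simp
  qed
  have poly_0: "p = 0" if "\<And>x. poly p (- x) = 0" for p :: "complex poly"
  proof -
    have "poly p x = 0" for x
      using that[of "- x"] by simp
    then show ?thesis
      by (intro poly_all_0_iff_0[THEN iffD1] allI)
  qed
  obtain J where J: "\<And>j. j \<in> K2 \<Longrightarrow> j < J"
    using finite_nat_set_iff_bounded K12(3) by auto
  have c1: "c (Inl (a, m)) = 0" if "(a, m) \<in> K1" for a m
  proof (rule poly_0)
    fix x
    show "poly (c (Inl (a, m))) (- x) = 0"
    proof (rule exp_monomial_sum_eq_0[of K1 J "\<lambda>k. poly (c (Inl k)) (- x)"])
      fix i assume "i \<ge> J"
      then have "(\<Sum>j\<in>K2. if i = j then poly (c (Inr j)) (- x) else 0) = 0"
        using J by (intro sum.neutral) fastforce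
      then show "(\<Sum>(a, m)\<in>K1. poly (c (Inl (a, m))) (- x) * (a ^ i * of_nat i ^ m)) = 0"
        using eval[of x i] by simp
    qed (use K12 nz that in auto)
  qed
  have c2: "c (Inr j) = 0" if "j \<in> K2" for j
  proof (rule poly_0)
    fix x
    have "(\<Sum>(a, m)\<in>K1. poly (c (Inl (a, m))) (- x) * (a ^ j * of_nat j ^ m)) = 0"
      using c1 by (intro sum.neutral) auto
    then show "poly (c (Inr j)) (- x) = 0"
      using eval[of x j] that K12(3) by simp
  qed
  show "\<forall>k\<in>K. c k = 0"
    using c1 c2 K12(1) by auto
qed

end

section \<open>Direct sums and finite rank\<close>

text \<open>The unique coefficients of a common element with respect to \<open>A \<union> B\<close>
  are supported both in \<open>A\<close> and in \<open>B\<close>, hence nowhere.\<close>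

lemma independent_span_Int:
  assumes "pd.independent (A \<union> B)" "A \<inter> B = {}"
  shows "pd.span A \<inter> pd.span B = {0}"
proof -
  have "x = 0" if A: "x \<in> pd.span A" and B: "x \<in> pd.span B" for x
  proof -
    let ?r = "pd.representation (A \<union> B) x"
    have AB: "x \<in> pd.span (A \<union> B)"
      using A pd.span_mono[of A "A \<union> B"] by blast
    have "?r = pd.representation A x" "?r = pd.representation B x"
      by (intro pd.representation_extend assms(1) A B; simp)+
    then have "?r b = 0" for b
      using pd.representation_ne_zero[of A x b] pd.representation_ne_zero[of B x b] assms(2) by force
    then show ?thesis
      using pd.sum_nonzero_representation_eq[OF assms(1) AB] by simp
  qed
  then show ?thesis
    using pd.span_zero by blast
qed

lemma independent_imp_direct_sum:
  assumes "pd.independent (A \<union> B)" "A \<inter> B = {}"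
  shows "is_direct_sum (pd.span A) (pd.span B) (pd.span (A \<union> B))"
  unfolding is_direct_sum_def
  by (simp add: independent_span_Int[OF assms] pd.span_Un)

lemma pd_basis_subfamily:
  assumes "pd_basis b I M" "inj_on g J" "g ` J \<subseteq> I"
  shows "pd_basis (b \<circ> g) J (pd.span ((b \<circ> g) ` J))"
  unfolding pd_basis_def
proof (intro conjI refl)
  show "inj_on (b \<circ> g) J"
    using assms by (intro comp_inj_on) (auto simp: pd_basis_def intro: inj_on_subset)
  show "pd.independent ((b \<circ> g) ` J)"
  proof (rule pd.independent_mono)
    show "pd.independent (b ` I)"
      using assms(1) by (simp add: pd_basis_def)
    show "(b \<circ> g) ` J \<subseteq> b ` I"
      using assms(3) by auto
  qed
qed

text \<open>p(\<partial>) acts as multiplication by p(-\<lambda>), a nonzero element of an integral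
  domain.\<close>

lemma cdual_torsion_free:
  assumes "p \<cdot>\<^sub>\<partial> f = (0 :: 'l::pd_module cdual)" "p \<noteq> 0"
  shows "f = 0"
proof (rule dual_eqI)
  fix u
  have "pcompose p [:0, -1:] * dual_apply f u = 0"
    using assms(1) by (simp add: dual_apply_pscale_left[symmetric] dual_apply_zero_left)
  moreover have "pcompose p [:0, -1:] \<noteq> 0"
    using assms(2) pcompose_eq_0[of p "[:0, -1:]"] by auto
  ultimately show "dual_apply f u = dual_apply 0 u"
    by (simp add: dual_apply_zero_left)
qed

text \<open>In the torsion-free dual the torsion part is 0, so the free summand is all of
  \<open>M\<close>.\<close>

lemma finite_rank_span:
  assumes "pd_basis a {..<n::nat} (M :: 'l::pd_module cdual set)"
  shows "finite_rank M"
proof -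
  have M: "pd.subspace M"
    using assms by (auto simp: pd_basis_def)
  have "torsion M = {0}"
  proof (rule equalityI)
    show "torsion M \<subseteq> {0}"
      using cdual_torsion_free by (auto simp: torsion_def)
    have "(1 :: complex poly) \<cdot>\<^sub>\<partial> (0 :: 'l cdual) = 0" "(1 :: complex poly) \<noteq> 0" by simp_all
    then show "{0} \<subseteq> torsion M"
      using pd.subspace_0[OF M] unfolding torsion_def by blast
  qed
  with M have "is_direct_sum M (torsion M) M"
    by (auto simp: is_direct_sum_def pd.subspace_0)
  with assms show ?thesis
    unfolding finite_rank_def by (intro exI conjI)
qed

section \<open>The basis of V + U, the largest good submodule and its Loc\<close>

context bracket_algebra
begin

abbreviation basis_family :: "(complex \<times> nat) + nat \<Rightarrow> 'l cdual"
  where "basis_family \<equiv> case_sum (\<lambda>(a, m). exp_poly_dual Lg a m) (dual_gen Lg)"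

abbreviation basis_index :: "((complex \<times> nat) + nat) set"
  where "basis_index \<equiv> ((- {0}) \<times> UNIV) <+> UNIV"

lemma basis_family_image:
  "basis_family ` basis_index = range (dual_gen Lg) \<union> {exp_poly_dual Lg a m |a m. a \<noteq> 0}"
  unfolding Plus_def image_Un image_image by force

lemma pd_basis_exp_poly_span: "pd_basis basis_family basis_index exp_poly_span"
  using family_independent_imp_pd_basis[OF family_independent_exp_poly_dual_gen]
  unfolding basis_family_image exp_poly_span_def .

lemma finite_rank_exp_poly_dual:
  assumes "a \<noteq> 0"
  shows "finite_rank (pd.span (exp_poly_dual Lg a ` {..m}))"
proof (rule finite_rank_span)
  have "pd_basis (basis_family \<circ> (\<lambda>j. Inl (a, j))) {..<Suc m}
      (pd.span ((basis_family \<circ> (\<lambda>j. Inl (a, j))) ` {..<Suc m}))"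
    using assms by (intro pd_basis_subfamily[OF pd_basis_exp_poly_span]) (auto simp: inj_on_def)
  then show "pd_basis (exp_poly_dual Lg a) {..<Suc m} (pd.span (exp_poly_dual Lg a ` {..m}))"
    by (simp add: comp_def lessThan_Suc_atMost)
qed

lemma finite_rank_dual_gen: "finite_rank (pd.span (dual_gen Lg ` {..m}))"
proof (rule finite_rank_span)
  have "pd_basis (basis_family \<circ> Inr) {..<Suc m} (pd.span ((basis_family \<circ> Inr) ` {..<Suc m}))"
    by (intro pd_basis_subfamily[OF pd_basis_exp_poly_span]) auto
  then show "pd_basis (dual_gen Lg) {..<Suc m} (pd.span (dual_gen Lg ` {..m}))"
    by (simp add: comp_def lessThan_Suc_atMost)
qed

lemma direct_sum_exp_poly_span:
  "is_direct_sum (pd.span (range (dual_gen Lg))) (pd.span {exp_poly_dual Lg a m |a m. a \<noteq> 0})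
    exp_poly_span"
  unfolding exp_poly_span_def
proof (rule independent_imp_direct_sum)
  have basis: "inj_on basis_family basis_index" "pd.independent (basis_family ` basis_index)"
    using pd_basis_exp_poly_span by (simp_all add: pd_basis_def)
  show "pd.independent (range (dual_gen Lg) \<union> {exp_poly_dual Lg a m |a m. a \<noteq> 0})"
    using basis(2) unfolding basis_family_image .
  have "dual_gen Lg j \<noteq> exp_poly_dual Lg a m" if "a \<noteq> 0" for j a m
    using inj_onD[OF basis(1), of "Inr j" "Inl (a, m)"] that by auto
  then show "range (dual_gen Lg) \<inter> {exp_poly_dual Lg a m |a m. a \<noteq> 0} = {}"
    by auto
qed

lemma exp_poly_span_minimal:
  assumes "pd.subspace W" "\<And>j. dual_gen Lg j \<in> W" "\<And>a m. a \<noteq> 0 \<Longrightarrow> exp_poly_dual Lg a m \<in> W"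
  shows "exp_poly_span \<subseteq> W"
  unfolding exp_poly_span_def using assms by (intro pd.span_minimal) auto

lemma exp_poly_span_subset_largest_good: "exp_poly_span \<subseteq> largest_good br"
proof (rule exp_poly_span_minimal)
  show "dual_gen Lg j \<in> largest_good br" for j
    using good_submodule_subset_largest_good[OF good_submodule_dual_gen[of j]]
    by (rule subsetD) (simp add: pd.span_base)
  show "exp_poly_dual Lg a m \<in> largest_good br" for a m
    using good_submodule_subset_largest_good[OF good_submodule_exp_poly_dual[of a m]]
    by (rule subsetD) (simp add: pd.span_base)
qed (use good_submodule_largest_good good_submodule_iff in simp)

text \<open>A cycle of inclusions closes: V + U lies in the largest good submodule, whose elements
  are linearly recursive, and these lie in V + U.\<close>

lemma largest_good_eq_linearly_recursive: "largest_good br = {g. linearly_recursive Lg g}"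
  and linearly_recursive_eq_exp_poly_span: "{g. linearly_recursive Lg g} = exp_poly_span"
  using exp_poly_span_subset_largest_good linearly_recursive_imp_exp_poly_span
    good_imp_linearly_recursive[OF good_submodule_largest_good] by fast+

text \<open>Every basis functional lies in the span of finitely many of its kind that is good and of
  finite rank, hence in a finite-rank subcoalgebra.\<close>

lemma Loc_largest_good: "Loc (largest_good br) (good_coproduct br (largest_good br)) = largest_good br"
proof (rule antisym)
  let ?L = "largest_good br" and ?\<delta> = "good_coproduct br (largest_good br)"
  have subspace: "pd.subspace ?L"
    using good_submodule_largest_good by (simp add: good_submodule_iff)
  show "Loc ?L ?\<delta> \<subseteq> ?L"
    unfolding Loc_def diff_lie_subcoalgebra_def by (intro pd.span_minimal subspace) blast
  have in_Loc: "g \<in> Loc ?L ?\<delta>" if "good_submodule br B" "finite_rank B" "g \<in> B" for B g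
  proof -
    have "diff_lie_subcoalgebra ?L ?\<delta> B"
      by (intro good_imp_diff_lie_subcoalgebra good_submodule_largest_good that
          good_submodule_subset_largest_good)
    with that show ?thesis
      unfolding Loc_def by (intro pd.span_base) blast
  qed
  have "exp_poly_span \<subseteq> Loc ?L ?\<delta>"
  proof (rule exp_poly_span_minimal)
    show "pd.subspace (Loc ?L ?\<delta>)"
      unfolding Loc_def by simp
    show "dual_gen Lg j \<in> Loc ?L ?\<delta>" for j
      by (rule in_Loc[OF good_submodule_dual_gen[of j] finite_rank_dual_gen]) (simp add: pd.span_base)
    show "exp_poly_dual Lg a m \<in> Loc ?L ?\<delta>" if "a \<noteq> 0" for a m
      by (rule in_Loc[OF good_submodule_exp_poly_dual[of a m] finite_rank_exp_poly_dual[OF that]])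
        (simp add: pd.span_base)
  qed
  then show "?L \<subseteq> Loc ?L ?\<delta>"
    by (simp only: largest_good_eq_linearly_recursive linearly_recursive_eq_exp_poly_span)
qed

end

theorem theorem5p6:
  fixes br :: "'l::pd_module \<Rightarrow> 'l \<Rightarrow> 'l poly"
    and Lg :: "nat \<Rightarrow> 'l"
    and Ls :: "nat \<Rightarrow> 'l cdual"
    and f :: "complex \<Rightarrow> nat \<Rightarrow> 'l cdual"
    and V U :: "'l cdual set"
  assumes "lie_conformal_algebra br"
    and "pd_basis Lg UNIV UNIV"
    and "\<And>i j. br (Lg i) (Lg j) = [:\<partial> (Lg (i + j)), 2 \<cdot>\<^sub>\<complex> Lg (i + j):]"
    and "Ls = dual_gen Lg"
    and "f = exp_poly_dual Lg"
    and "V = pd.span (range Ls)"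
    and "U = pd.span {f a m |a m. a \<noteq> 0}"
  shows
    "(good_submodule br U \<and>
      diff_lie_coalgebra U (good_coproduct br U) \<and>
      (\<forall>a m. a \<noteq> 0 \<longrightarrow> good_coproduct br U (f a m) =
        (\<Sum>j\<le>m. of_nat (m choose j) \<cdot>\<^sub>\<complex>
          (\<partial> (f a j) \<otimes> f a (m - j) - f a j \<otimes> \<partial> (f a (m - j)))))) \<and>
     pd_basis (case_sum (\<lambda>(a, m). f a m) Ls) (((- {0}) \<times> UNIV) <+> UNIV)
       {g. linearly_recursive Lg g} \<and>
     (is_direct_sum V U (largest_good br) \<and>
      largest_good br = {g. linearly_recursive Lg g}) \<and>
     (\<forall>a m. a \<noteq> 0 \<longrightarrow>
        diff_lie_subcoalgebra U (good_coproduct br U) (pd.span (f a ` {..m})) \<and>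
        finite_rank (pd.span (f a ` {..m}))) \<and>
     (is_direct_sum V U (Loc (largest_good br) (good_coproduct br (largest_good br))) \<and>
      Loc (largest_good br) (good_coproduct br (largest_good br)) = largest_good br)"
proof -
  interpret bracket_algebra Lg br
    using assms(1-3) by (intro bracket_algebra.intro free_generators.intro bracket_algebra_axioms.intro)
  have good_U: "good_submodule br U"
    unfolding assms(5,7) by (rule good_submodule_exp_poly_duals)
  then have subspace_U: "pd.subspace U"
    by (simp add: good_submodule_iff)
  have f_in_U: "f a m \<in> U" if "a \<noteq> 0" for a m
    unfolding assms(7) using that by (intro pd.span_base) blast
  have "good_coproduct br U (f a m) = (\<Sum>j\<le>m. of_nat (m choose j) \<cdot>\<^sub>\<complex>
      (\<partial> (f a j) \<otimes> f a (m - j) - f a j \<otimes> \<partial> (f a (m - j))))" if "a \<noteq> 0" for a m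
    by (rule good_coproduct_eq[OF subspace_U], unfold assms(5), rule has_coproduct_exp_poly_dual[OF subspace_U])
      (rule f_in_U[OF that, unfolded assms(5)])
  \<comment> \<open>The span is itself good, so the coproduct of \<open>U\<close> restricts to its
    own coproduct, with factors in the span.\<close>
  moreover have "diff_lie_subcoalgebra U (good_coproduct br U) (pd.span (f a ` {..m}))"
    if "a \<noteq> 0" for a m
  proof (rule good_imp_diff_lie_subcoalgebra[OF good_U])
    show "good_submodule br (pd.span (f a ` {..m}))"
      unfolding assms(5) by (rule good_submodule_exp_poly_dual)
    show "pd.span (f a ` {..m}) \<subseteq> U"
      using f_in_U[OF that] by (intro pd.span_minimal subspace_U) blast
  qed
  moreover have direct: "is_direct_sum V U (largest_good br)"
    unfolding assms(4-7) largest_good_eq_linearly_recursive linearly_recursive_eq_exp_poly_span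
    by (rule direct_sum_exp_poly_span)
  moreover have "pd_basis (case_sum (\<lambda>(a, m). f a m) Ls) (((- {0}) \<times> UNIV) <+> UNIV)
       {g. linearly_recursive Lg g}"
    unfolding assms(4,5) linearly_recursive_eq_exp_poly_span by (rule pd_basis_exp_poly_span)
  moreover have "finite_rank (pd.span (f a ` {..m}))" if "a \<noteq> 0" for a m
    unfolding assms(5) by (rule finite_rank_exp_poly_dual[OF that])
  ultimately show ?thesis
    using good_U good_imp_diff_lie_coalgebra[OF good_U] Loc_largest_good
      largest_good_eq_linearly_recursive by simp
qed

end
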